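(* Let $f_1,\dots,f_s$ be nonzero elements of $\mathbf F=\mathbb K[\![x_1,\dots,x_n]\!]$ and let $\mathbf A=\mathbb K[\![f_1,\dots,f_s]\!]$. Assume that there exists $n_0\in\mathbb N$ such that $e(\mathbf A,a)\le n_0$ for all $a\in U^n$. Then the set $\{\mathrm M(\mathbf A,a)\mid a\in U^n\}$ is finite (hence the set $\{\mathrm{exp}(\mathbf A,a)\mid a\in U^n\}$ is finite). In particular, the set $\{\mathrm{in}(\mathbf A,a)\mid a\in U^n\}$ is finite.
   Context: $\mathbb K$ is a field, $n\ge 1$, $\underline x=(x_1,\dots,x_n)$, $\mathbf F=\mathbb K[\![x_1,\dots,x_n]\!]$, $U=\mathbb R_{>0}$. Fix a total well ordering $\prec$ on $\mathbb N^n$ compatible with sums. For $a\in U^n$ and a nonzero $f=\sum c_\alpha\underline x^\alpha\in\mathbf F$: $\mathrm{Supp}(f)=\{\alpha\mid c_\alpha\ne0\}$; $\nu(f,a)=\min\{a\cdot\alpha\mid\alpha\in\mathrm{Supp}(f)\}$; $\mathrm{in}(f,a)=\sum_{\alpha\in\mathrm{Supp}(f),\,a\cdot\alpha=\nu(f,a)}c_\alpha\underline x^\alpha$ (a polynomial); $\mathrm{exp}(f,a)=\max_\prec\mathrm{Supp}(\mathrm{in}(f,a))$; $\mathrm M(f,a)=c_{\mathrm{exp}(f,a)}\underline x^{\mathrm{exp}(f,a)}$. For $S\subseteq\mathbf F$, $\mathbb K[\![S]\!]$ is the closure, in the $(x_1,\dots,x_n)$-adic topology, of the $\mathbb K$-subalgebra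 of $\mathbf F$ generated by $S$ (for a finite set $\{f_1,\dots,f_s\}$ of series without constant term it is the set of all formal power series in $f_1,\dots,f_s$). For a subalgebra $\mathbf A=\mathbb K[\![f_1,\dots,f_s]\!]$: $\mathrm{in}(\mathbf A,a)=\mathbb K[\![\mathrm{in}(f,a), f\in\mathbf A\setminus\{0\}]\!]$, $\mathrm M(\mathbf A,a)=\mathbb K[\![\mathrm M(f,a), f\in\mathbf A\setminus\{0\}]\!]$, and $\mathrm{exp}(\mathbf A,a)=\{\mathrm{exp}(f,a)\mid f\in\mathbf A\setminus\{0\}\}$, a subsemigroup of $\mathbb N^n$ containing $0$. A finite set $\{g_1,\dots,g_r\}\subseteq\mathbf A$ is an $a$-canonical basis of $\mathbf A$ if $\mathrm{exp}(\mathbf A,a)$ is generated by $\mathrm{exp}(g_1,a),\dots,\mathrm{exp}(g_r,a)$. It is minimal if $\{\mathrm M(g_1,a),\dots,\mathrm M(g_r,a)\}$ is a minimal set of generators of $\mathrm M(\mathbf A,a)$. It is reduced if it is minimal, each $\mathrm M(g_i,a)$ has coefficient $1$, and no $\alpha\in\mathrm{Supp}(g_i-\mathrm M(g_i,a))$ satisfies $\underline x^\alpha\in\mathrm M(\mathbf A,a)$. If $\mathrm{exp}(\mathbf A,a)$ is finitely generated, the $a$-reduced canonical basis exists and is unique; $e(\mathbf A,a)$ denotes its cardinality. If $\mathrm{exp}(\mathbf A,a)$ is not finitely generated, $e(\mathbf A,a)=+\infty$. *)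

theory Defs
  imports "HOL-Analysis.Finite_Cartesian_Product" "HOL-Analysis.Elementary_Topology" "HOL-Library.Extended_Nat"
begin

text \<open>Formal power series in variables indexed by the finite type \<open>'n\<close>; a series is its
  coefficient function on the exponents \<open>nat ^ 'n\<close>.\<close>

typedef ('a, 'n::finite) mfps = "UNIV :: (nat ^ 'n \<Rightarrow> 'a) set"
  morphisms mfps_nth Abs_mfps
  by simp

setup_lifting type_definition_mfps

lemma mfps_eqI: "(\<And>\<alpha>. mfps_nth f \<alpha> = mfps_nth g \<alpha>) \<Longrightarrow> f = g"
  by (metis ext mfps_nth_inject)

lemma finite_exponents_le: "finite {\<alpha> :: nat ^ 'n::finite. \<forall>i. \<alpha> $ i \<le> \<gamma> $ i}"
proof -
  have "finite (Pi\<^sub>E (UNIV :: 'n set) (\<lambda>i. {..\<gamma> $ i}))"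
    by (rule finite_PiE) auto
  moreover have "{\<alpha> :: nat ^ 'n. \<forall>i. \<alpha> $ i \<le> \<gamma> $ i}
      \<subseteq> vec_lambda ` (Pi\<^sub>E (UNIV :: 'n set) (\<lambda>i. {..\<gamma> $ i}))"
  proof
    fix \<alpha> :: "nat ^ 'n" assume "\<alpha> \<in> {\<alpha>. \<forall>i. \<alpha> $ i \<le> \<gamma> $ i}"
    then have "vec_nth \<alpha> \<in> Pi\<^sub>E UNIV (\<lambda>i. {..\<gamma> $ i})" by (auto simp: PiE_def)
    then have "vec_lambda (vec_nth \<alpha>) \<in> vec_lambda ` Pi\<^sub>E UNIV (\<lambda>i. {..\<gamma> $ i})"
      by (rule imageI)
    then show "\<alpha> \<in> vec_lambda ` Pi\<^sub>E UNIV (\<lambda>i. {..\<gamma> $ i})" by simp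
  qed
  ultimately show ?thesis by (meson finite_imageI finite_subset)
qed

lemma finite_exponent_splits: "finite {(\<alpha>, \<beta>). \<alpha> + \<beta> = (\<gamma> :: nat ^ 'n::finite)}"
  by (rule finite_subset[OF _ finite_cartesian_product[OF finite_exponents_le[of \<gamma>] finite_exponents_le[of \<gamma>]]])
     auto

instantiation mfps :: (comm_ring_1, finite) comm_ring_1
begin

lift_definition zero_mfps :: "('a, 'b) mfps" is "\<lambda>\<alpha>. 0" .
lift_definition one_mfps :: "('a, 'b) mfps" is "\<lambda>\<alpha>. if \<alpha> = 0 then 1 else 0" .
lift_definition plus_mfps :: "('a, 'b) mfps \<Rightarrow> ('a, 'b) mfps \<Rightarrow> ('a, 'b) mfps"
  is "\<lambda>f g \<alpha>. f \<alpha> + g \<alpha>" .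
lift_definition minus_mfps :: "('a, 'b) mfps \<Rightarrow> ('a, 'b) mfps \<Rightarrow> ('a, 'b) mfps"
  is "\<lambda>f g \<alpha>. f \<alpha> - g \<alpha>" .
lift_definition uminus_mfps :: "('a, 'b) mfps \<Rightarrow> ('a, 'b) mfps"
  is "\<lambda>f \<alpha>. - f \<alpha>" .
lift_definition times_mfps :: "('a, 'b) mfps \<Rightarrow> ('a, 'b) mfps \<Rightarrow> ('a, 'b) mfps"
  is "\<lambda>f g \<gamma>. \<Sum>(\<alpha>, \<beta>) | \<alpha> + \<beta> = \<gamma>. f \<alpha> * g \<beta>" .

instance
proof
  fix f g h :: "('a, 'b) mfps"
  show "f + g + h = f + (g + h)" "f + g = g + f" "0 + f = f" "- f + f = 0" "f - g = f + - g"
    by (transfer; simp add: algebra_simps)+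
  show "(0 :: ('a, 'b) mfps) \<noteq> 1"
    by transfer (metis zero_neq_one)
  show "f * g = g * f"
  proof (transfer, rule ext)
    fix f g :: "nat ^ 'b \<Rightarrow> 'a" and \<gamma>
    show "(\<Sum>(\<alpha>, \<beta>) | \<alpha> + \<beta> = \<gamma>. f \<alpha> * g \<beta>) = (\<Sum>(\<alpha>, \<beta>) | \<alpha> + \<beta> = \<gamma>. g \<alpha> * f \<beta>)"
      by (rule sum.reindex_bij_witness[where i = prod.swap and j = prod.swap])
         (auto simp: add.commute mult.commute)
  qed
  show "1 * f = f"
  proof (transfer, rule ext)
    fix f :: "nat ^ 'b \<Rightarrow> 'a" and \<gamma> :: "nat ^ 'b"
    let ?g = "\<lambda>(\<alpha> :: nat ^ 'b, \<beta>). (if \<alpha> = 0 then 1 else 0) * f \<beta>"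
    have "sum ?g {(\<alpha>, \<beta>). \<alpha> + \<beta> = \<gamma>} = sum ?g {(0, \<gamma>)}"
      by (rule sum.mono_neutral_right[OF finite_exponent_splits]) (auto split: if_splits)
    then show "sum ?g {(\<alpha>, \<beta>). \<alpha> + \<beta> = \<gamma>} = f \<gamma>" by simp
  qed
  show "(f + g) * h = f * h + g * h"
    by transfer (auto simp: distrib_right sum.distrib case_prod_unfold)
  show "f * g * h = f * (g * h)"
  proof (transfer, rule ext)
    fix f g h :: "nat ^ 'b \<Rightarrow> 'a" and \<gamma> :: "nat ^ 'b"
    let ?D = "\<lambda>\<delta> :: nat ^ 'b. {p. fst p + snd p = \<delta>}"
    have fin: "finite (?D \<delta>)" for \<delta>
      using finite_exponent_splits[of \<delta>] by (simp add: case_prod_unfold)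
    have "(\<Sum>p\<in>?D \<gamma>. (\<Sum>q\<in>?D (fst p). f (fst q) * g (snd q)) * h (snd p))
        = (\<Sum>(p, q)\<in>(SIGMA p:?D \<gamma>. ?D (fst p)). f (fst q) * g (snd q) * h (snd p))"
      by (simp add: sum_distrib_right sum.Sigma fin)
    also have "\<dots> = (\<Sum>(p, q)\<in>(SIGMA p:?D \<gamma>. ?D (snd p)). f (fst p) * (g (fst q) * h (snd q)))"
      by (rule sum.reindex_bij_witness[where
            i = "\<lambda>(p, q). ((fst p + fst q, snd q), (fst p, fst q))" and
            j = "\<lambda>(p, q). ((fst q, snd q + snd p), (snd q, snd p))"])
         (auto simp: algebra_simps)
    also have "\<dots> = (\<Sum>p\<in>?D \<gamma>. f (fst p) * (\<Sum>q\<in>?D (snd p). g (fst q) * h (snd q)))"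
      by (simp add: sum_distrib_left sum.Sigma fin)
    finally show "(\<Sum>(\<delta>, \<epsilon>) | \<delta> + \<epsilon> = \<gamma>. (\<Sum>(\<alpha>, \<beta>) | \<alpha> + \<beta> = \<delta>. f \<alpha> * g \<beta>) * h \<epsilon>)
        = (\<Sum>(\<delta>, \<epsilon>) | \<delta> + \<epsilon> = \<gamma>. f \<delta> * (\<Sum>(\<alpha>, \<beta>) | \<alpha> + \<beta> = \<epsilon>. g \<alpha> * h \<beta>))"
      by (simp add: case_prod_unfold)
  qed
qed

end

definition monomial :: "'a::zero \<Rightarrow> nat ^ 'n::finite \<Rightarrow> ('a, 'n) mfps" where
  "monomial c \<alpha> = Abs_mfps (\<lambda>\<beta>. if \<beta> = \<alpha> then c else 0)"

text \<open>The adic topology of the ideal generated by the variables: its \<open>N\<close>-th power consists of the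
  series whose coefficients of total degree below \<open>N\<close> vanish.\<close>

instantiation mfps :: (type, finite) topological_space
begin

definition open_mfps :: "('a, 'b) mfps set \<Rightarrow> bool" where
  "open_mfps U \<longleftrightarrow> (\<forall>f\<in>U. \<exists>N. \<forall>g.
     (\<forall>\<alpha>. (\<Sum>i\<in>UNIV. \<alpha> $ i) < N \<longrightarrow> mfps_nth g \<alpha> = mfps_nth f \<alpha>) \<longrightarrow> g \<in> U)"

instance
proof
  show "open (UNIV :: ('a, 'b) mfps set)" by (simp add: open_mfps_def)
next
  fix S T :: "('a, 'b) mfps set" assume ST: "open S" "open T"
  show "open (S \<inter> T)" unfolding open_mfps_def
  proof
    fix f assume "f \<in> S \<inter> T"
    with ST obtain M N where
      "\<forall>g. (\<forall>\<alpha>. (\<Sum>i\<in>UNIV. \<alpha> $ i) < M \<longrightarrow> mfps_nth g \<alpha> = mfps_nth f \<alpha>) \<longrightarrow> g \<in> S"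
      "\<forall>g. (\<forall>\<alpha>. (\<Sum>i\<in>UNIV. \<alpha> $ i) < N \<longrightarrow> mfps_nth g \<alpha> = mfps_nth f \<alpha>) \<longrightarrow> g \<in> T"
      unfolding open_mfps_def by (metis IntD1 IntD2)
    then show "\<exists>N. \<forall>g. (\<forall>\<alpha>. (\<Sum>i\<in>UNIV. \<alpha> $ i) < N \<longrightarrow> mfps_nth g \<alpha> = mfps_nth f \<alpha>) \<longrightarrow> g \<in> S \<inter> T"
      by (intro exI[of _ "max M N"]) auto
  qed
next
  fix K :: "('a, 'b) mfps set set" assume "\<forall>S\<in>K. open S"
  then show "open (\<Union>K)" unfolding open_mfps_def by (meson Union_iff)
qed

end

inductive_set generated_subalgebra :: "('a::comm_ring_1, 'n::finite) mfps set \<Rightarrow> ('a, 'n) mfps set"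
  for S where
  const: "monomial c 0 \<in> generated_subalgebra S"
| base: "f \<in> S \<Longrightarrow> f \<in> generated_subalgebra S"
| add: "f \<in> generated_subalgebra S \<Longrightarrow> g \<in> generated_subalgebra S \<Longrightarrow> f + g \<in> generated_subalgebra S"
| mult: "f \<in> generated_subalgebra S \<Longrightarrow> g \<in> generated_subalgebra S \<Longrightarrow> f * g \<in> generated_subalgebra S"

text \<open>\<open>\<bbbK>[[S]]\<close>\<close>

definition ps_algebra :: "('a::comm_ring_1, 'n::finite) mfps set \<Rightarrow> ('a, 'n) mfps set" where
  "ps_algebra S = closure (generated_subalgebra S)"

definition compatible_well_order :: "(nat ^ 'n::finite) rel \<Rightarrow> bool" where
  "compatible_well_order r \<longleftrightarrow>
     well_order_on UNIV r \<and> (\<forall>\<alpha> \<beta> \<gamma>. (\<alpha>, \<beta>) \<in> r \<longrightarrow> (\<alpha> + \<gamma>, \<beta> + \<gamma>) \<in> r)"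

definition positive_weights :: "(real ^ 'n::finite) set" where
  "positive_weights = {a. \<forall>i. a $ i > 0}"

definition weight :: "real ^ 'n::finite \<Rightarrow> nat ^ 'n \<Rightarrow> real" where
  "weight a \<alpha> = (\<Sum>i\<in>UNIV. a $ i * real (\<alpha> $ i))"

definition Supp :: "('a::zero, 'n::finite) mfps \<Rightarrow> (nat ^ 'n) set" where
  "Supp f = {\<alpha>. mfps_nth f \<alpha> \<noteq> 0}"

text \<open>The functions of a single series and a weight below are meaningful for nonzero series and
  positive weights only; then the minimum and the maximum exist. The order argument \<open>r\<close> is the
  reflexive version of the chosen well ordering of the exponents.\<close>

definition nu :: "('a::zero, 'n::finite) mfps \<Rightarrow> real ^ 'n \<Rightarrow> real" where
  "nu f a = (LEAST v. v \<in> weight a ` Supp f)"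

definition initial_form :: "('a::zero, 'n::finite) mfps \<Rightarrow> real ^ 'n \<Rightarrow> ('a, 'n) mfps" where
  "initial_form f a =
     Abs_mfps (\<lambda>\<alpha>. if \<alpha> \<in> Supp f \<and> weight a \<alpha> = nu f a then mfps_nth f \<alpha> else 0)"

definition lead_exp ::
    "(nat ^ 'n) rel \<Rightarrow> ('a::zero, 'n::finite) mfps \<Rightarrow> real ^ 'n \<Rightarrow> nat ^ 'n" where
  "lead_exp r f a = (THE \<mu>. \<mu> \<in> Supp (initial_form f a) \<and> (\<forall>\<alpha>\<in>Supp (initial_form f a). (\<alpha>, \<mu>) \<in> r))"

definition lead_monomial ::
    "(nat ^ 'n) rel \<Rightarrow> ('a::zero, 'n::finite) mfps \<Rightarrow> real ^ 'n \<Rightarrow> ('a, 'n) mfps" where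
  "lead_monomial r f a = monomial (mfps_nth f (lead_exp r f a)) (lead_exp r f a)"

definition initial_algebra ::
    "('a::comm_ring_1, 'n::finite) mfps set \<Rightarrow> real ^ 'n \<Rightarrow> ('a, 'n) mfps set" where
  "initial_algebra A a = ps_algebra ((\<lambda>f. initial_form f a) ` (A - {0}))"

definition lead_monomial_algebra ::
    "(nat ^ 'n) rel \<Rightarrow> ('a::comm_ring_1, 'n::finite) mfps set \<Rightarrow> real ^ 'n \<Rightarrow> ('a, 'n) mfps set" where
  "lead_monomial_algebra r A a = ps_algebra ((\<lambda>f. lead_monomial r f a) ` (A - {0}))"

definition lead_exps ::
    "(nat ^ 'n) rel \<Rightarrow> ('a::comm_ring_1, 'n::finite) mfps set \<Rightarrow> real ^ 'n \<Rightarrow> (nat ^ 'n) set" where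
  "lead_exps r A a = (\<lambda>f. lead_exp r f a) ` (A - {0})"

inductive_set generated_semigroup :: "(nat ^ 'n::finite) set \<Rightarrow> (nat ^ 'n) set"
  for E where
  zero: "0 \<in> generated_semigroup E"
| base: "\<alpha> \<in> E \<Longrightarrow> \<alpha> \<in> generated_semigroup E"
| add: "\<alpha> \<in> generated_semigroup E \<Longrightarrow> \<beta> \<in> generated_semigroup E \<Longrightarrow> \<alpha> + \<beta> \<in> generated_semigroup E"

definition canonical_basis ::
    "(nat ^ 'n) rel \<Rightarrow> ('a::comm_ring_1, 'n::finite) mfps set \<Rightarrow> real ^ 'n \<Rightarrow> ('a, 'n) mfps set \<Rightarrow> bool" where
  "canonical_basis r A a G \<longleftrightarrow> finite G \<and> G \<subseteq> A - {0} \<and>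
     lead_exps r A a = generated_semigroup ((\<lambda>g. lead_exp r g a) ` G)"

definition minimal_canonical_basis ::
    "(nat ^ 'n) rel \<Rightarrow> ('a::comm_ring_1, 'n::finite) mfps set \<Rightarrow> real ^ 'n \<Rightarrow> ('a, 'n) mfps set \<Rightarrow> bool" where
  "minimal_canonical_basis r A a G \<longleftrightarrow> canonical_basis r A a G \<and>
     ps_algebra ((\<lambda>g. lead_monomial r g a) ` G) = lead_monomial_algebra r A a \<and>
     (\<forall>H. H \<subset> (\<lambda>g. lead_monomial r g a) ` G \<longrightarrow> ps_algebra H \<noteq> lead_monomial_algebra r A a)"

definition reduced_canonical_basis ::
    "(nat ^ 'n) rel \<Rightarrow> ('a::comm_ring_1, 'n::finite) mfps set \<Rightarrow> real ^ 'n \<Rightarrow> ('a, 'n) mfps set \<Rightarrow> bool" where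
  "reduced_canonical_basis r A a G \<longleftrightarrow> minimal_canonical_basis r A a G \<and>
     (\<forall>g\<in>G. mfps_nth g (lead_exp r g a) = 1 \<and>
        (\<forall>\<alpha>\<in>Supp (g - lead_monomial r g a). monomial 1 \<alpha> \<notin> lead_monomial_algebra r A a))"

text \<open>\<open>e(A, a)\<close>\<close>

definition canonical_basis_size ::
    "(nat ^ 'n) rel \<Rightarrow> ('a::comm_ring_1, 'n::finite) mfps set \<Rightarrow> real ^ 'n \<Rightarrow> enat" where
  "canonical_basis_size r A a =
     (if \<exists>E. finite E \<and> lead_exps r A a = generated_semigroup E
      then enat (card (THE G. reduced_canonical_basis r A a G)) else \<infinity>)"

end

theory Submission
  imports Defs
begin

text \<open>
  Write \<open>S\<^sub>a\<close> for the semigroup of leading exponents of \<open>A\<close> with respect to \<open>a\<close>. Everything reduces to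
  showing that only finitely many semigroups \<open>S\<^sub>a\<close> occur: the algebra generated by the leading
  monomials consists of all series supported in \<open>S\<^sub>a\<close>, so it is a function of \<open>S\<^sub>a\<close>.

  Suppose that infinitely many weights give pairwise different \<open>S\<^sub>a\<close>. Each \<open>S\<^sub>a\<close> has at most \<open>N\<close>
  generators, with \<open>N\<close> independent of \<open>a\<close>. Passing to an infinite subfamily, each of the \<open>N\<close> generators
  is either the same for all weights or takes every value only finitely often, that is, escapes to
  infinity (\<open>infinite_subset_constant_or_finite_to_one\<close>). The semigroup \<open>L\<close> generated by the constant
  ones is then contained in every \<open>S\<^sub>a\<close> of the subfamily, and an exponent that lies in infinitely many
  \<open>S\<^sub>a\<close> lies in \<open>L\<close>, because generators too large to divide it cannot contribute
  (\<open>infinite_family_accumulates\<close>). Now take an element \<open>g\<close> of the reduced canonical basis for one of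
  these weights \<open>a\<close>. As the weight varies, \<open>g\<close> has only finitely many leading exponents
  (\<open>finite_lead_exp_values\<close>, from Dickson's lemma), so one of them, \<open>\<mu>\<close>, occurs for infinitely many
  weights of the subfamily. Hence \<open>\<mu> \<in> L \<subseteq> S\<^sub>a\<close>. But the only exponent of \<open>g\<close> in \<open>S\<^sub>a\<close> is its leading
  exponent with respect to \<open>a\<close>, so this one is \<open>\<mu>\<close> and lies in \<open>L\<close>. Thus \<open>S\<^sub>a\<close>, being generated by such
  exponents, equals \<open>L\<close> for all \<open>a\<close> in the subfamily, a contradiction (\<open>finite_lead_exps\<close>).

  The bound \<open>N\<close> is a bound on the cardinality of the reduced canonical basis, so its existence and
  uniqueness have to be established (\<open>reduced_canonical_basis_ex1\<close>). A positive weight together with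
  the tie-breaking order enumerates the exponents in order type omega. Therefore the exponents of an
  element of \<open>A\<close> that lie in \<open>S\<^sub>a\<close> can be eliminated one after the other, and the process converges
  in \<open>A\<close> because \<open>A\<close> is closed.

  For the initial algebras, a basis \<open>G\<close> that is reduced for \<open>a\<close> is canonical for every \<open>b\<close> with
  \<open>S\<^sub>b = S\<^sub>a\<close>, again because its elements meet \<open>S\<^sub>a\<close> in one exponent only
  (\<open>canonical_basis_transfer\<close>). The initial forms of a canonical basis generate the initial algebra
  (\<open>initial_algebra_eq\<close>), and each of the finitely many elements of \<open>G\<close> has finitely many initial forms.
\<close>

section \<open>Selection in infinite families and Dickson's lemma\<close>

text \<open>The pigeonhole principle, applied to finitely many functions at once: a function on an infinite
  set that is not finite-to-one is constant on an infinite subset, and restricting further to an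
  infinite subset destroys neither alternative for the functions treated before.\<close>

lemma infinite_subset_constant_or_finite_to_one:
  assumes "finite J" "infinite X"
  shows "\<exists>Y\<subseteq>X. infinite Y \<and>
    (\<forall>j\<in>J. (\<exists>c. \<forall>y\<in>Y. \<phi> j y = c) \<or> (\<forall>c. finite {y\<in>Y. \<phi> j y = c}))"
  using assms(1)
proof (induction J rule: finite_induct)
  case empty
  then show ?case using assms(2) by blast
next
  case (insert k J)
  then obtain Y where Y: "Y \<subseteq> X" "infinite Y"
    "\<forall>j\<in>J. (\<exists>c. \<forall>y\<in>Y. \<phi> j y = c) \<or> (\<forall>c. finite {y\<in>Y. \<phi> j y = c})" by blast
  show ?case
  proof (cases "\<forall>c. finite {y\<in>Y. \<phi> k y = c}")
    case True
    then show ?thesis using Y by blast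
  next
    case False
    then obtain c where c: "infinite {y\<in>Y. \<phi> k y = c}" by auto
    let ?Z = "{y\<in>Y. \<phi> k y = c}"
    have "(\<exists>d. \<forall>y\<in>?Z. \<phi> j y = d) \<or> (\<forall>d. finite {y\<in>?Z. \<phi> j y = d})" if "j \<in> J" for j
      using bspec[OF Y(3) that]
    proof
      assume fin: "\<forall>d. finite {y\<in>Y. \<phi> j y = d}"
      have "finite {y\<in>?Z. \<phi> j y = d}" for d
        by (rule finite_subset[OF _ fin[rule_format, of d]]) auto
      then show ?thesis by simp
    qed auto
    then show ?thesis using Y(1) c by (intro exI[of _ ?Z]) auto
  qed
qed

text \<open>The minimal elements of \<open>X\<close> do the job. They form an antichain; an infinite antichain would have an
  infinite subset on which each coordinate is constant or finite-to-one, and there all but finitely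
  many elements lie above any given one.\<close>

lemma dickson:
  fixes X :: "(nat ^ 'n::finite) set"
  shows "\<exists>D\<subseteq>X. finite D \<and> (\<forall>x\<in>X. \<exists>d\<in>D. \<forall>i. d $ i \<le> x $ i)"
proof -
  let ?D = "{d\<in>X. \<forall>x\<in>X. (\<forall>i. x $ i \<le> d $ i) \<longrightarrow> x = d}"
  have "finite ?D"
  proof (rule ccontr)
    assume "infinite ?D"
    then obtain Y where Y: "Y \<subseteq> ?D" "infinite Y" and
      alt: "\<forall>i\<in>UNIV. (\<exists>c. \<forall>y\<in>Y. y $ i = c) \<or> (\<forall>c. finite {y\<in>Y. y $ i = c})"
      using infinite_subset_constant_or_finite_to_one[of "UNIV :: 'n set" ?D "\<lambda>i y. y $ i"] by auto
    from Y(2) obtain x where x: "x \<in> Y" by fastforce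
    have "finite {y\<in>Y. y $ i < x $ i}" for i
    proof (cases "\<exists>c. \<forall>y\<in>Y. y $ i = c")
      case True
      then have "{y\<in>Y. y $ i < x $ i} = {}" using x by fastforce
      then show ?thesis by (simp only: finite.emptyI)
    next
      case False
      have "{y\<in>Y. y $ i < x $ i} = (\<Union>c\<in>{..<x $ i}. {y\<in>Y. y $ i = c})" by auto
      moreover have "\<forall>c. finite {y\<in>Y. y $ i = c}" using False bspec[OF alt UNIV_I] by metis
      ultimately show ?thesis by simp
    qed
    then have "finite (insert x (\<Union>i. {y\<in>Y. y $ i < x $ i}))" by simp
    then obtain y where "y \<in> Y" "y \<notin> insert x (\<Union>i. {y\<in>Y. y $ i < x $ i})"
      using Y(2) by (meson finite_subset subsetI)
    then have "y \<noteq> x" "\<forall>i. x $ i \<le> y $ i" "y \<in> ?D" "x \<in> X" using x Y(1) by (auto simp: not_less)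
    then show False by blast
  qed
  moreover have "\<exists>d\<in>?D. \<forall>i. d $ i \<le> x $ i" if "x \<in> X" for x
    using that
  proof (induction "\<Sum>i\<in>UNIV. x $ i" arbitrary: x rule: less_induct)
    case less
    show ?case
    proof (cases "x \<in> ?D")
      case False
      then obtain y where y: "y \<in> X" "\<forall>i. y $ i \<le> x $ i" "y \<noteq> x" using less.prems by blast
      then obtain j where "y $ j \<noteq> x $ j" by (auto simp: vec_eq_iff)
      with y have "(\<Sum>i\<in>UNIV. y $ i) < (\<Sum>i\<in>UNIV. x $ i)"
        by (intro sum_strict_mono_ex1) (auto simp: le_less)
      from less.hyps[OF this y(1)] obtain d where "d \<in> ?D" "\<forall>i. d $ i \<le> y $ i" ..
      moreover from this y(2) have "\<forall>i. d $ i \<le> x $ i" by (meson order_trans)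
      ultimately show ?thesis by (intro bexI)
    qed blast
  qed
  ultimately show ?thesis by (intro exI[of _ ?D]) auto
qed

section \<open>Subsemigroups of the exponents\<close>

lemma generated_semigroup_subset:
  assumes "E \<subseteq> T" "0 \<in> T" "\<And>\<alpha> \<beta>. \<alpha> \<in> T \<Longrightarrow> \<beta> \<in> T \<Longrightarrow> \<alpha> + \<beta> \<in> T"
  shows "generated_semigroup E \<subseteq> T"
proof
  fix \<alpha> assume "\<alpha> \<in> generated_semigroup E"
  then show "\<alpha> \<in> T" by induction (use assms in auto)
qed

lemma generated_semigroup_least:
  "E \<subseteq> generated_semigroup F \<Longrightarrow> generated_semigroup E \<subseteq> generated_semigroup F"
  by (intro generated_semigroup_subset generated_semigroup.zero generated_semigroup.add)

lemma generated_semigroup_mono: "E \<subseteq> F \<Longrightarrow> generated_semigroup E \<subseteq> generated_semigroup F"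
  by (auto intro!: generated_semigroup_least intro: generated_semigroup.base)

lemma generated_semigroup_insert_zero: "generated_semigroup (insert 0 E) = generated_semigroup E"
  by (intro equalityI generated_semigroup_least)
     (auto intro: generated_semigroup.base generated_semigroup.zero)

text \<open>Exponents are nonnegative, so the summands in a representation are bounded by the sum. This
  localises membership: generators far away are irrelevant for a given exponent.\<close>

lemma generated_semigroup_below:
  "\<alpha> \<in> generated_semigroup E \<Longrightarrow> \<alpha> \<in> generated_semigroup {\<beta>\<in>E. \<forall>i. \<beta> $ i \<le> \<alpha> $ i}"
proof (induction rule: generated_semigroup.induct)
  case (add \<alpha> \<beta>)
  have "{\<gamma>\<in>E. \<forall>i. \<gamma> $ i \<le> \<alpha> $ i} \<subseteq> {\<gamma>\<in>E. \<forall>i. \<gamma> $ i \<le> (\<alpha> + \<beta>) $ i}"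
    "{\<gamma>\<in>E. \<forall>i. \<gamma> $ i \<le> \<beta> $ i} \<subseteq> {\<gamma>\<in>E. \<forall>i. \<gamma> $ i \<le> (\<alpha> + \<beta>) $ i}"
    by (auto simp: trans_le_add1 trans_le_add2)
  with add.IH show ?case by (meson generated_semigroup.add generated_semigroup_mono subsetD)
qed (auto intro: generated_semigroup.intros)

text \<open>In a subsemigroup of \<open>nat ^ 'n\<close> the irreducibles form the unique minimal generating set, which is
  what makes a reduced canonical basis unique.\<close>

definition irreducibles :: "(nat ^ 'n::finite) set \<Rightarrow> (nat ^ 'n) set" where
  "irreducibles S = {\<alpha>\<in>S - {0}. \<forall>\<beta>\<in>S. \<forall>\<gamma>\<in>S. \<alpha> = \<beta> + \<gamma> \<longrightarrow> \<beta> = 0 \<or> \<gamma> = 0}"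

lemma irreducibles_subset_generators: "irreducibles (generated_semigroup E) \<subseteq> E"
proof
  fix \<alpha> assume "\<alpha> \<in> irreducibles (generated_semigroup E)"
  then have "\<alpha> \<in> generated_semigroup E" "\<alpha> \<in> irreducibles (generated_semigroup E)"
    by (auto simp: irreducibles_def)
  then show "\<alpha> \<in> E"
  proof induction
    case (add \<alpha> \<beta>)
    then have "\<alpha> = 0 \<or> \<beta> = 0" by (auto simp: irreducibles_def)
    with add show ?case by auto
  qed (auto simp: irreducibles_def)
qed

lemma sum_vec_pos: "(\<alpha> :: nat ^ 'n::finite) \<noteq> 0 \<Longrightarrow> (\<Sum>i\<in>UNIV. \<alpha> $ i) > 0"
  by (rule ccontr) (simp add: vec_eq_iff)

lemma generated_semigroup_irreducibles:
  assumes "0 \<in> S" "\<And>\<alpha> \<beta>. \<alpha> \<in> S \<Longrightarrow> \<beta> \<in> S \<Longrightarrow> \<alpha> + \<beta> \<in> S"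
  shows "generated_semigroup (irreducibles S) = S"
proof
  show "generated_semigroup (irreducibles S) \<subseteq> S"
    by (rule generated_semigroup_subset) (use assms in \<open>auto simp: irreducibles_def\<close>)
  show "S \<subseteq> generated_semigroup (irreducibles S)"
  proof
    fix \<alpha> assume "\<alpha> \<in> S"
    then show "\<alpha> \<in> generated_semigroup (irreducibles S)"
    proof (induction "\<Sum>i\<in>UNIV. \<alpha> $ i" arbitrary: \<alpha> rule: less_induct)
      case less
      show ?case
      proof (cases "\<alpha> = 0 \<or> \<alpha> \<in> irreducibles S")
        case True
        then show ?thesis by (auto intro: generated_semigroup.intros)
      next
        case False
        then obtain \<beta> \<gamma> where *: "\<beta> \<in> S" "\<gamma> \<in> S" "\<alpha> = \<beta> + \<gamma>" "\<beta> \<noteq> 0" "\<gamma> \<noteq> 0"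
          using less.prems by (auto simp: irreducibles_def)
        have "(\<Sum>i\<in>UNIV. \<beta> $ i) < (\<Sum>i\<in>UNIV. \<alpha> $ i)" "(\<Sum>i\<in>UNIV. \<gamma> $ i) < (\<Sum>i\<in>UNIV. \<alpha> $ i)"
          using *(3) sum_vec_pos[OF *(4)] sum_vec_pos[OF *(5)] by (simp_all add: sum.distrib)
        with less.hyps * show ?thesis by (auto intro: generated_semigroup.add)
      qed
    qed
  qed
qed

section \<open>Closed subalgebras\<close>

lemmas mfps_nth_simps [simp] =
  zero_mfps.rep_eq plus_mfps.rep_eq minus_mfps.rep_eq uminus_mfps.rep_eq

lemma mfps_nth_monomial [simp]: "mfps_nth (monomial c \<alpha>) \<beta> = (if \<beta> = \<alpha> then c else 0)"
  by (simp add: monomial_def Abs_mfps_inverse)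

lemma mfps_nth_times:
  "mfps_nth (f * g) \<gamma> = (\<Sum>p | fst p + snd p = \<gamma>. mfps_nth f (fst p) * mfps_nth g (snd p))"
  by (simp add: times_mfps.rep_eq case_prod_unfold)

lemma in_Supp_iff: "\<alpha> \<in> Supp f \<longleftrightarrow> mfps_nth f \<alpha> \<noteq> 0"
  by (simp add: Supp_def)

lemma Supp_eq_empty_iff: "Supp f = {} \<longleftrightarrow> f = 0"
  by (auto simp: Supp_def intro!: mfps_eqI)

lemma monomial_one_zero: "monomial 1 0 = 1"
  by (rule mfps_eqI) (simp add: one_mfps.rep_eq)

text \<open>Every comparison of coefficients in a product below concerns an exponent that arises from the two
  supports in a single way, so that the convolution has one term.\<close>

lemma mfps_nth_times_unique_split:
  assumes "\<And>\<alpha>' \<beta>'. \<alpha>' \<in> Supp f \<Longrightarrow> \<beta>' \<in> Supp g \<Longrightarrow> \<alpha>' + \<beta>' = \<alpha> + \<beta> \<Longrightarrow> \<alpha>' = \<alpha> \<and> \<beta>' = \<beta>"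
  shows "mfps_nth (f * g) (\<alpha> + \<beta>) = mfps_nth f \<alpha> * mfps_nth g \<beta>"
proof -
  let ?h = "\<lambda>p. mfps_nth f (fst p) * mfps_nth g (snd p)"
  have "sum ?h {p. fst p + snd p = \<alpha> + \<beta>} = sum ?h {(\<alpha>, \<beta>)}"
  proof (rule sum.mono_neutral_right)
    show "finite {p. fst p + snd p = \<alpha> + \<beta>}"
      using finite_exponent_splits[of "\<alpha> + \<beta>"] by (simp add: case_prod_unfold)
    show "\<forall>p\<in>{p. fst p + snd p = \<alpha> + \<beta>} - {(\<alpha>, \<beta>)}. ?h p = 0"
    proof
      fix p assume p: "p \<in> {p. fst p + snd p = \<alpha> + \<beta>} - {(\<alpha>, \<beta>)}"
      then have "\<not> (fst p \<in> Supp f \<and> snd p \<in> Supp g)"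
        using assms[of "fst p" "snd p"] by (auto simp: prod_eq_iff)
      then show "?h p = 0" by (auto simp: in_Supp_iff)
    qed
  qed auto
  then show ?thesis by (simp add: mfps_nth_times)
qed

lemma Supp_times_subset: "\<gamma> \<in> Supp (f * g) \<Longrightarrow> \<exists>\<alpha>\<in>Supp f. \<exists>\<beta>\<in>Supp g. \<gamma> = \<alpha> + \<beta>"
proof (rule ccontr)
  assume *: "\<gamma> \<in> Supp (f * g)" "\<not> (\<exists>\<alpha>\<in>Supp f. \<exists>\<beta>\<in>Supp g. \<gamma> = \<alpha> + \<beta>)"
  then have "mfps_nth (f * g) \<gamma> = 0"
    unfolding mfps_nth_times
  proof (intro sum.neutral ballI)
    fix p assume "p \<in> {p. fst p + snd p = \<gamma>}"
    with *(2) have "fst p \<notin> Supp f \<or> snd p \<notin> Supp g" by blast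
    then show "mfps_nth f (fst p) * mfps_nth g (snd p) = 0" by (auto simp: in_Supp_iff)
  qed
  with * show False by (simp add: in_Supp_iff)
qed

lemma mfps_nth_scalar_times [simp]: "mfps_nth (monomial c 0 * (f :: ('a::comm_ring_1, 'b::finite) mfps)) \<gamma> = c * mfps_nth f \<gamma>"
proof -
  have "mfps_nth (monomial c 0 * f) (0 + \<gamma>) = mfps_nth (monomial c (0 :: nat ^ 'b)) 0 * mfps_nth f \<gamma>"
    by (rule mfps_nth_times_unique_split) (auto simp: in_Supp_iff split: if_splits)
  then show ?thesis by simp
qed

lemma monomial_times_monomial: "monomial c \<alpha> * monomial d \<beta> = monomial (c * d) (\<alpha> + \<beta>)"
proof (rule mfps_eqI)
  fix \<gamma>
  show "mfps_nth (monomial c \<alpha> * monomial d \<beta>) \<gamma> = mfps_nth (monomial (c * d) (\<alpha> + \<beta>)) \<gamma>"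
  proof (cases "\<gamma> = \<alpha> + \<beta>")
    case True
    have "mfps_nth (monomial c \<alpha> * monomial d \<beta>) (\<alpha> + \<beta>) =
        mfps_nth (monomial c \<alpha>) \<alpha> * mfps_nth (monomial d \<beta>) \<beta>"
      by (rule mfps_nth_times_unique_split) (auto simp: in_Supp_iff split: if_splits)
    with True show ?thesis by simp
  next
    case False
    then have "\<gamma> \<notin> Supp (monomial c \<alpha> * monomial d \<beta>)"
      using Supp_times_subset[of \<gamma> "monomial c \<alpha>" "monomial d \<beta>"]
      by (fastforce simp: in_Supp_iff split: if_splits)
    with False show ?thesis by (simp add: in_Supp_iff)
  qed
qed

lemma mem_closure_mfps_iff:
  "f \<in> closure T \<longleftrightarrow>
    (\<forall>N. \<exists>g\<in>T. \<forall>\<alpha>. (\<Sum>i\<in>UNIV. \<alpha> $ i) < N \<longrightarrow> mfps_nth g \<alpha> = mfps_nth f \<alpha>)" (is "_ \<longleftrightarrow> ?R")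
proof
  assume f: "f \<in> closure T"
  show ?R
  proof
    fix N
    let ?B = "{g. \<forall>\<alpha>. (\<Sum>i\<in>UNIV. \<alpha> $ i) < N \<longrightarrow> mfps_nth g \<alpha> = mfps_nth f \<alpha>}"
    have "open ?B" unfolding open_mfps_def by (intro ballI exI[of _ N]) auto
    moreover have "f \<in> ?B" by simp
    ultimately have "T \<inter> ?B \<noteq> {}" using f unfolding closure_iff_nhds_not_empty by blast
    then show "\<exists>g\<in>T. \<forall>\<alpha>. (\<Sum>i\<in>UNIV. \<alpha> $ i) < N \<longrightarrow> mfps_nth g \<alpha> = mfps_nth f \<alpha>" by blast
  qed
next
  assume R: ?R
  show "f \<in> closure T"
    unfolding closure_iff_nhds_not_empty
  proof (intro allI impI)
    fix V U assume "U \<subseteq> V" "open U" "f \<in> U"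
    then obtain N where N: "\<forall>g. (\<forall>\<alpha>. (\<Sum>i\<in>UNIV. \<alpha> $ i) < N \<longrightarrow> mfps_nth g \<alpha> = mfps_nth f \<alpha>) \<longrightarrow> g \<in> U"
      unfolding open_mfps_def by blast
    with R \<open>U \<subseteq> V\<close> show "T \<inter> V \<noteq> {}" by blast
  qed
qed

definition closed_subalgebra :: "('a::comm_ring_1, 'n::finite) mfps set \<Rightarrow> bool" where
  "closed_subalgebra A \<longleftrightarrow> closed A \<and> (\<forall>c. monomial c 0 \<in> A) \<and>
     (\<forall>f\<in>A. \<forall>g\<in>A. f + g \<in> A \<and> f * g \<in> A)"

lemma closed_subalgebraD:
  assumes "closed_subalgebra A"
  shows "closed A" "monomial c 0 \<in> A" "f \<in> A \<Longrightarrow> g \<in> A \<Longrightarrow> f + g \<in> A"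
    "f \<in> A \<Longrightarrow> g \<in> A \<Longrightarrow> f * g \<in> A"
  using assms by (auto simp: closed_subalgebra_def)

lemma closed_subalgebra_diff:
  assumes "closed_subalgebra A" "f \<in> A" "g \<in> A"
  shows "f - g \<in> A"
proof -
  have "f - g = f + monomial (- 1) 0 * g" by (rule mfps_eqI) simp
  then show ?thesis using closed_subalgebraD[OF assms(1)] assms by metis
qed

lemma ps_algebra_subset:
  assumes "closed_subalgebra A" "T \<subseteq> A"
  shows "ps_algebra T \<subseteq> A"
  unfolding ps_algebra_def
proof (rule closure_minimal)
  show "generated_subalgebra T \<subseteq> A"
  proof
    fix f assume "f \<in> generated_subalgebra T"
    then show "f \<in> A" by induction (use assms in \<open>auto simp: closed_subalgebra_def\<close>)
  qed
qed (use assms in \<open>auto simp: closed_subalgebra_def\<close>)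

lemma generated_subalgebra_subset_ps_algebra: "generated_subalgebra T \<subseteq> ps_algebra T"
  by (simp add: ps_algebra_def closure_subset)

lemma mfps_nth_times_cong:
  assumes "\<And>\<alpha>. (\<Sum>i\<in>UNIV. \<alpha> $ i) < N \<Longrightarrow> mfps_nth f \<alpha> = mfps_nth f' \<alpha>"
    "\<And>\<alpha>. (\<Sum>i\<in>UNIV. \<alpha> $ i) < N \<Longrightarrow> mfps_nth g \<alpha> = mfps_nth g' \<alpha>"
    "(\<Sum>i\<in>UNIV. \<gamma> $ i) < N"
  shows "mfps_nth (f * g) \<gamma> = mfps_nth (f' * g') \<gamma>"
  unfolding mfps_nth_times
proof (rule sum.cong)
  fix p assume "p \<in> {p. fst p + snd p = \<gamma>}"
  then have "(\<Sum>i\<in>UNIV. fst p $ i) + (\<Sum>i\<in>UNIV. snd p $ i) = (\<Sum>i\<in>UNIV. \<gamma> $ i)"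
    by (auto simp: sum.distrib)
  with assms show "mfps_nth f (fst p) * mfps_nth g (snd p) = mfps_nth f' (fst p) * mfps_nth g' (snd p)"
    by (metis add_lessD1 add.commute)
qed simp

lemma closed_subalgebra_ps_algebra: "closed_subalgebra (ps_algebra T)"
  unfolding closed_subalgebra_def
proof (intro conjI ballI allI)
  show "closed (ps_algebra T)" by (simp add: ps_algebra_def)
  show "monomial c 0 \<in> ps_algebra T" for c
    using generated_subalgebra_subset_ps_algebra generated_subalgebra.const by blast
  fix f g assume "f \<in> ps_algebra T" "g \<in> ps_algebra T"
  then have fg: "\<exists>f'\<in>generated_subalgebra T. \<forall>\<alpha>. (\<Sum>i\<in>UNIV. \<alpha> $ i) < N \<longrightarrow> mfps_nth f' \<alpha> = mfps_nth f \<alpha>"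
    "\<exists>g'\<in>generated_subalgebra T. \<forall>\<alpha>. (\<Sum>i\<in>UNIV. \<alpha> $ i) < N \<longrightarrow> mfps_nth g' \<alpha> = mfps_nth g \<alpha>" for N
    unfolding ps_algebra_def mem_closure_mfps_iff by auto
  show "f + g \<in> ps_algebra T"
    unfolding ps_algebra_def mem_closure_mfps_iff
  proof
    fix N
    obtain f' g' where "f' \<in> generated_subalgebra T" "g' \<in> generated_subalgebra T"
      "\<forall>\<alpha>. (\<Sum>i\<in>UNIV. \<alpha> $ i) < N \<longrightarrow> mfps_nth f' \<alpha> = mfps_nth f \<alpha>"
      "\<forall>\<alpha>. (\<Sum>i\<in>UNIV. \<alpha> $ i) < N \<longrightarrow> mfps_nth g' \<alpha> = mfps_nth g \<alpha>"
      using fg[of N] by blast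
    then show "\<exists>h\<in>generated_subalgebra T.
        \<forall>\<alpha>. (\<Sum>i\<in>UNIV. \<alpha> $ i) < N \<longrightarrow> mfps_nth h \<alpha> = mfps_nth (f + g) \<alpha>"
      by (intro bexI[of _ "f' + g'"]) (auto intro: generated_subalgebra.add)
  qed
  show "f * g \<in> ps_algebra T"
    unfolding ps_algebra_def mem_closure_mfps_iff
  proof
    fix N
    obtain f' g' where "f' \<in> generated_subalgebra T" "g' \<in> generated_subalgebra T"
      "\<forall>\<alpha>. (\<Sum>i\<in>UNIV. \<alpha> $ i) < N \<longrightarrow> mfps_nth f' \<alpha> = mfps_nth f \<alpha>"
      "\<forall>\<alpha>. (\<Sum>i\<in>UNIV. \<alpha> $ i) < N \<longrightarrow> mfps_nth g' \<alpha> = mfps_nth g \<alpha>"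
      using fg[of N] by blast
    then show "\<exists>h\<in>generated_subalgebra T.
        \<forall>\<alpha>. (\<Sum>i\<in>UNIV. \<alpha> $ i) < N \<longrightarrow> mfps_nth h \<alpha> = mfps_nth (f * g) \<alpha>"
      by (intro bexI[of _ "f' * g'"]) (auto intro: generated_subalgebra.mult mfps_nth_times_cong)
  qed
qed

lemma ps_algebra_mono: "T \<subseteq> T' \<Longrightarrow> ps_algebra T \<subseteq> ps_algebra T'"
  by (rule ps_algebra_subset[OF closed_subalgebra_ps_algebra])
     (use generated_subalgebra_subset_ps_algebra generated_subalgebra.base in blast)

lemma finite_total_degree_less: "finite {\<alpha> :: nat ^ 'n::finite. (\<Sum>i\<in>UNIV. \<alpha> $ i) < N}"
proof (rule finite_subset[OF _ finite_exponents_le[of "\<chi> i. N"]], safe)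
  fix \<alpha> :: "nat ^ 'n" and i assume "(\<Sum>i\<in>UNIV. \<alpha> $ i) < N"
  moreover have "\<alpha> $ i \<le> (\<Sum>i\<in>UNIV. \<alpha> $ i)" by (rule member_le_sum) auto
  ultimately show "\<alpha> $ i \<le> (\<chi> i. N) $ i" by simp
qed

text \<open>Truncating a series supported in the semigroup gives a finite sum of products of the generating
  monomials, and the truncations converge to the series; conversely, series supported in a given
  semigroup form a closed subalgebra. Arbitrary nonzero coefficients are allowed since over a field
  they can be scaled away.\<close>

lemma ps_algebra_monomials:
  fixes T :: "('k::field, 'n::finite) mfps set"
  assumes T: "\<And>t. t \<in> T \<Longrightarrow> \<exists>c. \<exists>\<alpha>\<in>E. t = monomial c \<alpha>"
    and E: "\<And>\<alpha>. \<alpha> \<in> E \<Longrightarrow> \<exists>c. c \<noteq> 0 \<and> monomial c \<alpha> \<in> T"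
  shows "ps_algebra T = {f. Supp f \<subseteq> generated_semigroup E}" (is "_ = ?R")
proof
  have "closed_subalgebra ?R"
    unfolding closed_subalgebra_def
  proof (intro conjI ballI allI)
    have "f \<in> ?R" if f: "f \<in> closure ?R" for f
    proof -
      have "\<alpha> \<in> generated_semigroup E" if "\<alpha> \<in> Supp f" for \<alpha>
      proof -
        obtain g where "g \<in> ?R" "mfps_nth g \<alpha> = mfps_nth f \<alpha>"
          using f unfolding mem_closure_mfps_iff by (metis lessI)
        with that show ?thesis by (auto simp: in_Supp_iff)
      qed
      then show ?thesis by auto
    qed
    then show "closed ?R" by (metis closure_subset closed_closure subsetI subset_antisym)
    show "monomial c 0 \<in> ?R" for c
      by (auto simp: in_Supp_iff intro: generated_semigroup.zero split: if_splits)
    fix f g assume fg: "f \<in> ?R" "g \<in> ?R"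
    then show "f + g \<in> ?R" by (auto simp: in_Supp_iff) (metis add.right_neutral in_Supp_iff subsetD)
    from fg show "f * g \<in> ?R" by (auto dest!: Supp_times_subset intro!: generated_semigroup.add)
  qed
  moreover have "T \<subseteq> ?R"
    using T by (fastforce simp: in_Supp_iff intro: generated_semigroup.base split: if_splits)
  ultimately show "ps_algebra T \<subseteq> ?R" by (rule ps_algebra_subset)
  have mono: "monomial c \<alpha> \<in> generated_subalgebra T" if "\<alpha> \<in> generated_semigroup E" for c \<alpha>
    using that
  proof (induction arbitrary: c)
    case (base \<alpha>)
    then obtain d where d: "d \<noteq> 0" "monomial d \<alpha> \<in> T" using E by blast
    then have "monomial c \<alpha> = monomial (c / d) 0 * monomial d \<alpha>" by (simp add: monomial_times_monomial)
    then show ?case using d by (metis generated_subalgebra.const generated_subalgebra.base generated_subalgebra.mult)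
  next
    case (add \<alpha> \<beta>)
    have "monomial c (\<alpha> + \<beta>) = monomial 1 \<alpha> * monomial c \<beta>" by (simp add: monomial_times_monomial)
    then show ?case using add.IH by (metis generated_subalgebra.mult)
  qed (rule generated_subalgebra.const)
  show "?R \<subseteq> ps_algebra T"
  proof
    fix f assume f: "f \<in> ?R"
    show "f \<in> ps_algebra T"
      unfolding ps_algebra_def mem_closure_mfps_iff
    proof
      fix N
      have trunc: "finite B \<Longrightarrow>
          \<exists>g\<in>generated_subalgebra T. \<forall>\<alpha>. mfps_nth g \<alpha> = (if \<alpha> \<in> B then mfps_nth f \<alpha> else 0)" for B
      proof (induction B rule: finite_induct)
        case empty
        then show ?case using generated_subalgebra.const[of 0 T] by (intro bexI) auto
      next
        case (insert \<beta> B)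
        then obtain g where g: "g \<in> generated_subalgebra T"
          "\<forall>\<alpha>. mfps_nth g \<alpha> = (if \<alpha> \<in> B then mfps_nth f \<alpha> else 0)" by blast
        have "monomial (mfps_nth f \<beta>) \<beta> \<in> generated_subalgebra T"
        proof (cases "\<beta> \<in> Supp f")
          case True
          then show ?thesis using f mono by blast
        next
          case False
          then have "monomial (mfps_nth f \<beta>) \<beta> = monomial 0 0" by (intro mfps_eqI) (auto simp: in_Supp_iff)
          then show ?thesis by (metis generated_subalgebra.const)
        qed
        with g insert.hyps show ?case
          by (intro bexI[of _ "g + monomial (mfps_nth f \<beta>) \<beta>"]) (auto intro: generated_subalgebra.add)
      qed
      show "\<exists>g\<in>generated_subalgebra T. \<forall>\<alpha>. (\<Sum>i\<in>UNIV. \<alpha> $ i) < N \<longrightarrow> mfps_nth g \<alpha> = mfps_nth f \<alpha>"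
        using trunc[OF finite_total_degree_less[of N]] by (smt (verit) mem_Collect_eq)
    qed
  qed
qed

lemma ps_algebra_unit_monomials:
  "ps_algebra (monomial (1 :: 'k::field) ` E) = {f. Supp f \<subseteq> generated_semigroup E}"
  by (rule ps_algebra_monomials) (auto intro!: exI[of _ 1])

section \<open>Leading exponents and reduction for orders of type omega\<close>

text \<open>An additive total order in which every element has finitely many predecessors is recorded by the
  position \<open>rk \<alpha>\<close> of each exponent. Smaller rank means closer to the leading exponent, so the
  leading exponent of a series has minimal rank, and reduction can proceed by recursion on the rank.\<close>

locale omega_order =
  fixes rk :: "nat ^ 'n::finite \<Rightarrow> nat"
  assumes inj_rk: "inj rk"
    and rk_add_right: "rk \<alpha> < rk \<beta> \<Longrightarrow> rk (\<alpha> + \<gamma>) < rk (\<beta> + \<gamma>)"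
begin

lemma rk_eq_iff [simp]: "rk \<alpha> = rk \<beta> \<longleftrightarrow> \<alpha> = \<beta>"
  using inj_rk by (auto dest: injD)

lemma rk_add_mono:
  assumes "rk \<alpha> \<le> rk \<alpha>'" "rk \<beta> \<le> rk \<beta>'"
  shows "rk (\<alpha> + \<beta>) \<le> rk (\<alpha>' + \<beta>')" "\<alpha> + \<beta> = \<alpha>' + \<beta>' \<Longrightarrow> \<alpha> = \<alpha>' \<and> \<beta> = \<beta>'"
proof -
  have 1: "\<alpha> = \<alpha>' \<or> rk (\<alpha> + \<beta>) < rk (\<alpha>' + \<beta>)" using assms(1) rk_add_right by (metis le_neq_implies_less rk_eq_iff)
  have 2: "\<beta> = \<beta>' \<or> rk (\<alpha>' + \<beta>) < rk (\<alpha>' + \<beta>')"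
    using assms(2) rk_add_right by (metis add.commute le_neq_implies_less rk_eq_iff)
  from 1 2 show "rk (\<alpha> + \<beta>) \<le> rk (\<alpha>' + \<beta>')" by auto
  assume "\<alpha> + \<beta> = \<alpha>' + \<beta>'"
  with 1 2 show "\<alpha> = \<alpha>' \<and> \<beta> = \<beta>'" by (metis less_asym less_irrefl)
qed

definition lead :: "('a::zero, 'n) mfps \<Rightarrow> nat ^ 'n" where
  "lead f = (ARG_MIN rk \<alpha>. \<alpha> \<in> Supp f)"

lemma
  fixes f :: "('k::field, 'n) mfps"
  assumes "f \<noteq> 0"
  shows lead_in_Supp: "lead f \<in> Supp f" and lead_least: "\<alpha> \<in> Supp f \<Longrightarrow> rk (lead f) \<le> rk \<alpha>"
proof -
  obtain \<beta> where "\<beta> \<in> Supp f" using assms Supp_eq_empty_iff[of f] by auto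
  from arg_min_nat_lemma[of "\<lambda>\<alpha>. \<alpha> \<in> Supp f", OF this, of rk]
  show "lead f \<in> Supp f" "\<alpha> \<in> Supp f \<Longrightarrow> rk (lead f) \<le> rk \<alpha>" by (auto simp: lead_def)
qed

lemma lead_eqI:
  fixes f :: "('k::field, 'n) mfps"
  assumes "\<mu> \<in> Supp f" "\<And>\<alpha>. \<alpha> \<in> Supp f \<Longrightarrow> rk \<mu> \<le> rk \<alpha>"
  shows "lead f = \<mu>"
proof -
  have "f \<noteq> 0" using assms(1) by (auto simp: in_Supp_iff)
  from lead_in_Supp[OF this] lead_least[OF this assms(1)] assms(2) show ?thesis
    by (metis le_antisym rk_eq_iff)
qed

lemma
  fixes f g :: "('k::field, 'n) mfps"
  assumes "f \<noteq> 0" "g \<noteq> 0"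
  shows mfps_nth_times_lead: "mfps_nth (f * g) (lead f + lead g) = mfps_nth f (lead f) * mfps_nth g (lead g)"
    and times_nonzero: "f * g \<noteq> 0"
    and lead_times: "lead (f * g) = lead f + lead g"
proof -
  show 1: "mfps_nth (f * g) (lead f + lead g) = mfps_nth f (lead f) * mfps_nth g (lead g)"
  proof (rule mfps_nth_times_unique_split)
    fix \<alpha> \<beta> assume "\<alpha> \<in> Supp f" "\<beta> \<in> Supp g" "\<alpha> + \<beta> = lead f + lead g"
    then show "\<alpha> = lead f \<and> \<beta> = lead g"
      using rk_add_mono(2)[of "lead f" \<alpha> "lead g" \<beta>] lead_least assms by metis
  qed
  then have 2: "lead f + lead g \<in> Supp (f * g)"
    using lead_in_Supp[OF assms(1)] lead_in_Supp[OF assms(2)] by (simp add: in_Supp_iff)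
  then show "f * g \<noteq> 0" by (auto simp: in_Supp_iff)
  show "lead (f * g) = lead f + lead g"
  proof (rule lead_eqI[OF 2])
    fix \<gamma> assume "\<gamma> \<in> Supp (f * g)"
    then obtain \<alpha> \<beta> where "\<alpha> \<in> Supp f" "\<beta> \<in> Supp g" "\<gamma> = \<alpha> + \<beta>" by (blast dest: Supp_times_subset)
    then show "rk (lead f + lead g) \<le> rk \<gamma>" using rk_add_mono(1) lead_least assms by metis
  qed
qed

lemma lead_monomial_zero: "(c :: 'k::field) \<noteq> 0 \<Longrightarrow> lead (monomial c 0) = 0"
  by (rule lead_eqI) (auto simp: in_Supp_iff split: if_splits)

lemma
  fixes A :: "('k::field, 'n) mfps set"
  assumes "closed_subalgebra A"
  shows zero_in_lead_image: "0 \<in> lead ` (A - {0})"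
    and add_in_lead_image: "\<alpha> \<in> lead ` (A - {0}) \<Longrightarrow> \<beta> \<in> lead ` (A - {0}) \<Longrightarrow> \<alpha> + \<beta> \<in> lead ` (A - {0})"
proof -
  have "monomial 1 0 \<in> A - {0}" using closed_subalgebraD(2)[OF assms, of 1] by (simp add: monomial_one_zero)
  then show "0 \<in> lead ` (A - {0})" using lead_monomial_zero[of "1 :: 'k"] by force
  assume "\<alpha> \<in> lead ` (A - {0})" "\<beta> \<in> lead ` (A - {0})"
  then obtain f g where "f \<in> A - {0}" "g \<in> A - {0}" "\<alpha> = lead f" "\<beta> = lead g" by auto
  then have "f * g \<in> A - {0}" "\<alpha> + \<beta> = lead (f * g)"
    using closed_subalgebraD(4)[OF assms] by (auto simp: times_nonzero lead_times)
  then show "\<alpha> + \<beta> \<in> lead ` (A - {0})" by blast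
qed

text \<open>The difference of two candidates lies in \<open>A\<close>, but it has no exponent left among the leading exponents
  of \<open>A\<close>, so it vanishes.\<close>

lemma reduced_element_unique:
  fixes A :: "('k::field, 'n) mfps set"
  assumes "closed_subalgebra A" and f: "f \<in> A" "Supp f \<inter> lead ` (A - {0}) = {e}" "mfps_nth f e = 1"
    and g: "g \<in> A" "Supp g \<inter> lead ` (A - {0}) = {e}" "mfps_nth g e = 1"
  shows "f = g"
proof (rule ccontr)
  assume "f \<noteq> g"
  then have nz: "f - g \<noteq> 0" by simp
  with closed_subalgebra_diff[OF assms(1) f(1) g(1)] have "lead (f - g) \<in> lead ` (A - {0})" by blast
  moreover have "mfps_nth f (lead (f - g)) \<noteq> mfps_nth g (lead (f - g))"
    using lead_in_Supp[OF nz] by (simp add: in_Supp_iff)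
  ultimately have "lead (f - g) \<in> Supp f \<inter> lead ` (A - {0}) \<or> lead (f - g) \<in> Supp g \<inter> lead ` (A - {0})"
    by (auto simp: in_Supp_iff simp del: image_eqI)
  then have "lead (f - g) = e" unfolding f(2) g(2) by simp
  with lead_in_Supp[OF nz] f(3) g(3) show False by (simp add: in_Supp_iff)
qed

text \<open>Start with an element of \<open>A\<close> with leading exponent \<open>e\<close> and run through the ranks: when rank \<open>k\<close> belongs
  to a leading exponent \<open>\<alpha> \<noteq> e\<close> of \<open>A\<close>, subtract the multiple of an element with leading exponent \<open>\<alpha>\<close>
  that removes \<open>\<alpha>\<close> from the support. This changes no coefficient of rank below \<open>k\<close>, so each coefficient
  is eventually constant and the limit lies in the closed set \<open>A\<close>.\<close>

lemma reduced_element_exists: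
  fixes A :: "('k::field, 'n) mfps set"
  assumes A: "closed_subalgebra A" and e: "e \<in> lead ` (A - {0})"
  shows "\<exists>g\<in>A. Supp g \<inter> lead ` (A - {0}) = {e} \<and> mfps_nth g e = 1"
proof -
  let ?S = "lead ` (A - {0})"
  have "\<exists>h\<in>A. mfps_nth h \<alpha> = 1 \<and> (\<forall>\<beta>. rk \<beta> < rk \<alpha> \<longrightarrow> mfps_nth h \<beta> = 0)" if \<alpha>: "\<alpha> \<in> ?S" for \<alpha>
  proof -
    from \<alpha> obtain f where f: "f \<in> A" "f \<noteq> 0" "lead f = \<alpha>" by auto
    let ?h = "monomial (1 / mfps_nth f \<alpha>) 0 * f"
    have "?h \<in> A" using closed_subalgebraD[OF A] f(1) by blast
    moreover have "mfps_nth ?h \<alpha> = 1" using lead_in_Supp[OF f(2)] f(3) by (simp add: in_Supp_iff)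
    moreover have "mfps_nth ?h \<beta> = 0" if "rk \<beta> < rk \<alpha>" for \<beta>
      using lead_least[OF f(2), of \<beta>] f(3) that by (auto simp: in_Supp_iff)
    ultimately show ?thesis by blast
  qed
  then obtain h where hA: "\<And>\<alpha>. \<alpha> \<in> ?S \<Longrightarrow> h \<alpha> \<in> A" and h1: "\<And>\<alpha>. \<alpha> \<in> ?S \<Longrightarrow> mfps_nth (h \<alpha>) \<alpha> = 1"
    and h0: "\<And>\<alpha> \<beta>. \<alpha> \<in> ?S \<Longrightarrow> rk \<beta> < rk \<alpha> \<Longrightarrow> mfps_nth (h \<alpha>) \<beta> = 0"
    by metis
  \<comment> \<open>\<open>inv rk k\<close> is unspecified when no exponent has rank \<open>k\<close>; the test \<open>rk (inv rk k) = k\<close> skips that case.\<close>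
  define step where "step k u =
    (if inv rk k \<in> ?S - {e} \<and> rk (inv rk k) = k
     then u - monomial (mfps_nth u (inv rk k)) 0 * h (inv rk k) else u)" for k u
  define g where "g = rec_nat (h e) step"
  have g0: "g 0 = h e" and gSuc: "g (Suc k) = step k (g k)" for k by (simp_all add: g_def)
  have inv_rk: "inv rk (rk \<alpha>) = \<alpha>" for \<alpha> using inj_rk by simp
  have gA: "g k \<in> A" for k
  proof (induction k)
    case (Suc k)
    then show ?case unfolding gSuc step_def
      using closed_subalgebra_diff[OF A] closed_subalgebraD[OF A] hA by auto
  qed (use g0 hA e in simp)
  have stable_step: "mfps_nth (g (Suc k)) \<beta> = mfps_nth (g k) \<beta>" if "rk \<beta> < k" for k \<beta>
    unfolding gSuc step_def using h0[of "inv rk k" \<beta>] that by auto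
  have stable: "mfps_nth (g m) \<beta> = mfps_nth (g (Suc (rk \<beta>))) \<beta>" if "Suc (rk \<beta>) \<le> m" for m \<beta>
    using that
  proof (induction m rule: dec_induct)
    case (step m)
    then show ?case using stable_step[of \<beta> m] by simp
  qed simp
  have cleared: "mfps_nth (g (Suc (rk \<beta>))) \<beta> = 0" if "\<beta> \<in> ?S - {e}" for \<beta>
    unfolding gSuc step_def using that h1[of \<beta>] by (simp add: inv_rk)
  \<comment> \<open>Coefficients of rank below that of \<open>e\<close> stay 0, so the steps at these ranks subtract nothing, and the
    later steps do not reach back to \<open>e\<close>.\<close>
  have inv: "mfps_nth (g k) e = 1 \<and> (\<forall>\<beta>. rk \<beta> < rk e \<longrightarrow> mfps_nth (g k) \<beta> = 0)" for k
  proof (induction k)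
    case (Suc k)
    show ?case
    proof (cases "inv rk k \<in> ?S - {e} \<and> rk (inv rk k) = k")
      case True
      then have "k \<noteq> rk e" by (metis DiffE inv_rk singletonI)
      then show ?thesis
      proof (rule linorder_neqE_nat)
        assume "k < rk e"
        then have "mfps_nth (g k) (inv rk k) = 0" using Suc True by simp
        then show ?thesis using Suc True by (simp add: gSuc step_def)
      next
        assume "rk e < k"
        then show ?thesis using Suc True h0[of "inv rk k"] by (auto simp: gSuc step_def)
      qed
    next
      case False
      then have "g (Suc k) = g k" unfolding gSuc step_def by (simp only: if_False)
      then show ?thesis using Suc by simp
    qed
  qed (use g0 h0 h1 e in simp)
  define G where "G = Abs_mfps (\<lambda>\<beta>. mfps_nth (g (Suc (rk \<beta>))) \<beta>)"
  have G: "mfps_nth G \<beta> = mfps_nth (g (Suc (rk \<beta>))) \<beta>" for \<beta> by (simp add: G_def Abs_mfps_inverse)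
  have "G \<in> closure A"
    unfolding mem_closure_mfps_iff
  proof
    fix N
    let ?D = "{\<alpha> :: nat ^ 'n. (\<Sum>i\<in>UNIV. \<alpha> $ i) < N}"
    \<comment> \<open>After \<open>m\<close> steps all coefficients of total degree below \<open>N\<close> have reached their final value.\<close>
    define m where "m = Suc (\<Sum>\<alpha>\<in>?D. rk \<alpha>)"
    have "Suc (rk \<alpha>) \<le> m" if "\<alpha> \<in> ?D" for \<alpha>
      using member_le_sum[OF that, of rk] finite_total_degree_less[of N] by (simp add: m_def)
    then have "mfps_nth (g m) \<alpha> = mfps_nth G \<alpha>" if "\<alpha> \<in> ?D" for \<alpha>
      using stable G that by metis
    then show "\<exists>f\<in>A. \<forall>\<alpha>. (\<Sum>i\<in>UNIV. \<alpha> $ i) < N \<longrightarrow> mfps_nth f \<alpha> = mfps_nth G \<alpha>"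
      using gA by (intro bexI[of _ "g m"]) auto
  qed
  then have "G \<in> A" using closed_subalgebraD(1)[OF A] by simp
  moreover have "mfps_nth G e = 1" using G inv by simp
  moreover have "Supp G \<inter> ?S = {e}"
  proof (intro equalityI subsetI)
    fix \<beta> assume "\<beta> \<in> Supp G \<inter> ?S"
    then show "\<beta> \<in> {e}" using cleared[of \<beta>] G[of \<beta>] unfolding in_Supp_iff Int_iff by fastforce
  next
    fix \<beta> assume "\<beta> \<in> {e}"
    then show "\<beta> \<in> Supp G \<inter> ?S" using \<open>mfps_nth G e = 1\<close> e by (simp add: in_Supp_iff)
  qed
  ultimately show ?thesis by blast
qed

end

section \<open>The order attached to a positive weight\<close>

lemma weight_add: "weight a (\<alpha> + \<beta>) = weight a \<alpha> + weight a \<beta>"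
  by (simp add: weight_def algebra_simps sum.distrib)

text \<open>Positivity of all components of \<open>a\<close> enters here: it is what makes the order attached to \<open>a\<close> have
  type omega.\<close>

lemma finite_weight_le:
  assumes "a \<in> positive_weights"
  shows "finite {\<alpha>. weight a \<alpha> \<le> v}"
proof (rule finite_subset[OF _ finite_exponents_le[of "\<chi> i. nat \<lceil>v / a $ i\<rceil>"]], safe)
  fix \<alpha> i assume \<alpha>: "weight a \<alpha> \<le> v"
  have pos: "a $ j > 0" for j using assms by (simp add: positive_weights_def)
  have "a $ i * real (\<alpha> $ i) \<le> weight a \<alpha>"
    unfolding weight_def by (rule member_le_sum) (use pos in \<open>auto simp: less_imp_le\<close>)
  with \<alpha> have "real (\<alpha> $ i) \<le> v / a $ i" using pos[of i] by (simp add: field_simps)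
  then show "\<alpha> $ i \<le> (\<chi> i. nat \<lceil>v / a $ i\<rceil>) $ i" by simp linarith
qed

text \<open>Among exponents of equal weight, the larger one for \<open>r\<close> comes first, so that \<open>lead_exp\<close>, the maximum for
  \<open>r\<close> of the initial form, becomes the first exponent of the whole support.\<close>

definition precedes :: "(nat ^ 'n::finite) rel \<Rightarrow> real ^ 'n \<Rightarrow> nat ^ 'n \<Rightarrow> nat ^ 'n \<Rightarrow> bool" where
  "precedes r a \<alpha> \<beta> \<longleftrightarrow>
    weight a \<alpha> < weight a \<beta> \<or> weight a \<alpha> = weight a \<beta> \<and> (\<beta>, \<alpha>) \<in> r \<and> \<alpha> \<noteq> \<beta>"

definition rank :: "(nat ^ 'n::finite) rel \<Rightarrow> real ^ 'n \<Rightarrow> nat ^ 'n \<Rightarrow> nat" where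
  "rank r a \<beta> = card {\<alpha>. precedes r a \<alpha> \<beta>}"

lemma compatible_well_orderD:
  assumes "compatible_well_order r"
  shows "(\<alpha>, \<alpha>) \<in> r" "(\<alpha>, \<beta>) \<in> r \<Longrightarrow> (\<beta>, \<gamma>) \<in> r \<Longrightarrow> (\<alpha>, \<gamma>) \<in> r"
    "(\<alpha>, \<beta>) \<in> r \<Longrightarrow> (\<beta>, \<alpha>) \<in> r \<Longrightarrow> \<alpha> = \<beta>" "(\<alpha>, \<beta>) \<in> r \<or> (\<beta>, \<alpha>) \<in> r"
    "(\<alpha>, \<beta>) \<in> r \<Longrightarrow> (\<alpha> + \<gamma>, \<beta> + \<gamma>) \<in> r" "wf (r - Id)"
  using assms unfolding compatible_well_order_def well_order_on_def linear_order_on_def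
    partial_order_on_def preorder_on_def refl_on_def total_on_def
  by (auto dest: transD antisymD) (metis UNIV_I)+

lemma precedes_total:
  assumes "compatible_well_order r"
  shows "precedes r a \<alpha> \<beta> \<or> \<alpha> = \<beta> \<or> precedes r a \<beta> \<alpha>"
  using compatible_well_orderD(4)[OF assms] unfolding precedes_def by (metis linorder_neqE)

lemma rank_less_iff:
  assumes r: "compatible_well_order r" and a: "a \<in> positive_weights"
  shows "rank r a \<alpha> < rank r a \<beta> \<longleftrightarrow> precedes r a \<alpha> \<beta>"
proof -
  have less: "rank r a \<alpha> < rank r a \<beta>" if "precedes r a \<alpha> \<beta>" for \<alpha> \<beta>
    unfolding rank_def
  proof (rule psubset_card_mono)
    show "finite {\<gamma>. precedes r a \<gamma> \<beta>}"
      by (rule finite_subset[OF _ finite_weight_le[OF a, of "weight a \<beta>"]]) (auto simp: precedes_def)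
    have "precedes r a \<gamma> \<beta>" if \<gamma>: "precedes r a \<gamma> \<alpha>" for \<gamma>
    proof (cases "weight a \<gamma> = weight a \<alpha> \<and> weight a \<alpha> = weight a \<beta>")
      case True
      then have *: "(\<beta>, \<alpha>) \<in> r" "(\<alpha>, \<gamma>) \<in> r" "\<gamma> \<noteq> \<alpha>"
        using \<gamma> \<open>precedes r a \<alpha> \<beta>\<close> by (auto simp: precedes_def)
      have "(\<beta>, \<gamma>) \<in> r" by (rule compatible_well_orderD(2)[OF r *(1,2)])
      moreover have "\<gamma> \<noteq> \<beta>" using * compatible_well_orderD(3)[OF r] by blast
      ultimately show ?thesis using True by (simp add: precedes_def)
    qed (use \<gamma> \<open>precedes r a \<alpha> \<beta>\<close> in \<open>auto simp: precedes_def\<close>)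
    moreover have "\<not> precedes r a \<alpha> \<alpha>" by (simp add: precedes_def)
    ultimately show "{\<gamma>. precedes r a \<gamma> \<alpha>} \<subset> {\<gamma>. precedes r a \<gamma> \<beta>}" using that by blast
  qed
  with less precedes_total[OF r] show ?thesis by (metis less_asym less_irrefl)
qed

lemma omega_order_rank:
  assumes r: "compatible_well_order r" and a: "a \<in> positive_weights"
  shows "omega_order (rank r a)"
proof
  show "inj (rank r a)"
    by (intro injI) (metis rank_less_iff[OF assms] precedes_total[OF r] less_irrefl)
  show "rank r a (\<alpha> + \<gamma>) < rank r a (\<beta> + \<gamma>)" if "rank r a \<alpha> < rank r a \<beta>" for \<alpha> \<beta> \<gamma>
    using that compatible_well_orderD(5)[OF r]
    by (auto simp: rank_less_iff[OF assms] precedes_def weight_add)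
qed

lemma weight_mono_rank:
  assumes "compatible_well_order r" "a \<in> positive_weights" "rank r a \<alpha> \<le> rank r a \<beta>"
  shows "weight a \<alpha> \<le> weight a \<beta>"
proof -
  have "\<not> precedes r a \<beta> \<alpha>" using assms(3) by (simp add: rank_less_iff[OF assms(1,2), symmetric])
  then show ?thesis by (simp add: precedes_def)
qed

definition homogeneous_part ::
    "real ^ 'n \<Rightarrow> real \<Rightarrow> ('a::zero, 'n::finite) mfps \<Rightarrow> ('a, 'n) mfps" where
  "homogeneous_part a v f = Abs_mfps (\<lambda>\<alpha>. if weight a \<alpha> = v then mfps_nth f \<alpha> else 0)"

lemma mfps_nth_homogeneous_part [simp]:
  "mfps_nth (homogeneous_part a v f) \<alpha> = (if weight a \<alpha> = v then mfps_nth f \<alpha> else 0)"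
  by (simp add: homogeneous_part_def Abs_mfps_inverse)

lemma initial_form_eq: "initial_form f a = homogeneous_part a (nu f a) f"
  by (rule mfps_eqI) (simp add: initial_form_def Abs_mfps_inverse in_Supp_iff)

context
  fixes r :: "(nat ^ 'n::finite) rel" and a :: "real ^ 'n"
  assumes r: "compatible_well_order r" and a: "a \<in> positive_weights"
begin

interpretation omega_order "rank r a" by (rule omega_order_rank[OF r a])

lemma nu_eq:
  fixes f :: "('k::field, 'n) mfps"
  assumes "f \<noteq> 0"
  shows "nu f a = weight a (lead f)"
  unfolding nu_def
  by (rule Least_equality)
     (use lead_in_Supp[OF assms] lead_least[OF assms] weight_mono_rank[OF r a] in auto)

lemma lead_exp_eq:
  fixes f :: "('k::field, 'n) mfps"
  assumes "f \<noteq> 0"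
  shows "lead_exp r f a = lead f"
proof -
  have supp: "Supp (initial_form f a) = {\<alpha>\<in>Supp f. weight a \<alpha> = weight a (lead f)}"
    by (auto simp: initial_form_eq in_Supp_iff nu_eq[OF assms] split: if_splits)
  have "\<alpha> = lead f \<or> (\<alpha>, lead f) \<in> r" if "\<alpha> \<in> Supp (initial_form f a)" for \<alpha>
  proof -
    have "rank r a (lead f) \<le> rank r a \<alpha>" using that lead_least[OF assms] by (simp add: supp)
    then consider "\<alpha> = lead f" | "rank r a (lead f) < rank r a \<alpha>" by (metis le_neq_implies_less rk_eq_iff)
    then show ?thesis using that by cases (auto simp: supp rank_less_iff[OF r a] precedes_def)
  qed
  then have max: "\<forall>\<alpha>\<in>Supp (initial_form f a). (\<alpha>, lead f) \<in> r" using compatible_well_orderD(1)[OF r] by metis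
  moreover have mem: "lead f \<in> Supp (initial_form f a)" using lead_in_Supp[OF assms] by (simp add: supp)
  ultimately show ?thesis
    unfolding lead_exp_def using compatible_well_orderD(3)[OF r] by (intro the_equality) blast+
qed

lemma lead_exps_eq: "lead_exps r (A :: ('k::field, 'n) mfps set) a = lead ` (A - {0})"
  unfolding lead_exps_def by (rule image_cong) (auto simp: lead_exp_eq)

lemma lead_exp_in_Supp: "(f :: ('k::field, 'n) mfps) \<noteq> 0 \<Longrightarrow> lead_exp r f a \<in> Supp f"
  by (simp add: lead_exp_eq lead_in_Supp)

section \<open>Existence and uniqueness of reduced canonical bases\<close>

lemma generated_semigroup_lead_exps:
  fixes A :: "('k::field, 'n) mfps set"
  assumes "closed_subalgebra A"
  shows "generated_semigroup (lead_exps r A a) = lead_exps r A a"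
    and "generated_semigroup (irreducibles (lead_exps r A a)) = lead_exps r A a"
proof -
  have S: "0 \<in> lead_exps r A a"
    "\<And>\<alpha> \<beta>. \<alpha> \<in> lead_exps r A a \<Longrightarrow> \<beta> \<in> lead_exps r A a \<Longrightarrow> \<alpha> + \<beta> \<in> lead_exps r A a"
    unfolding lead_exps_eq using zero_in_lead_image[OF assms] add_in_lead_image[OF assms] by blast+
  show "generated_semigroup (lead_exps r A a) = lead_exps r A a"
    using generated_semigroup_subset[OF order_refl S] by (auto intro: generated_semigroup.base)
  show "generated_semigroup (irreducibles (lead_exps r A a)) = lead_exps r A a"
    by (rule generated_semigroup_irreducibles) (use S in blast)+
qed

lemma lead_monomial_algebra_eq:
  fixes A :: "('k::field, 'n) mfps set"
  assumes "closed_subalgebra A"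
  shows "lead_monomial_algebra r A a = {f. Supp f \<subseteq> lead_exps r A a}"
proof -
  have "ps_algebra ((\<lambda>f. lead_monomial r f a) ` (A - {0})) =
      {f. Supp f \<subseteq> generated_semigroup (lead_exps r A a)}"
  proof (rule ps_algebra_monomials)
    fix t assume "t \<in> (\<lambda>f. lead_monomial r f a) ` (A - {0})"
    then show "\<exists>c. \<exists>\<alpha>\<in>lead_exps r A a. t = monomial c \<alpha>"
      by (auto simp: lead_monomial_def lead_exps_def)
  next
    fix \<alpha> assume "\<alpha> \<in> lead_exps r A a"
    then obtain f where "f \<in> A - {0}" "\<alpha> = lead_exp r f a" by (auto simp: lead_exps_def)
    then show "\<exists>c. c \<noteq> 0 \<and> monomial c \<alpha> \<in> (\<lambda>f. lead_monomial r f a) ` (A - {0})"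
      using lead_exp_in_Supp[of f]
      by (intro exI[of _ "mfps_nth f \<alpha>"]) (auto simp: lead_monomial_def in_Supp_iff)
  qed
  then show ?thesis
    by (simp add: lead_monomial_algebra_def generated_semigroup_lead_exps[OF assms])
qed

text \<open>Translation of the conditions on algebras into conditions on exponents. Since the algebra of leading
  monomials consists of the series supported in \<open>lead_exps r A a\<close>, reducedness says that \<open>g\<close> meets this
  semigroup in its leading exponent only, and minimality that the leading exponents of the basis are
  irreducible.\<close>

lemma reduced_canonical_basisD:
  fixes A :: "('k::field, 'n) mfps set"
  assumes A: "closed_subalgebra A" and G: "reduced_canonical_basis r A a G"
  shows "finite G" "G \<subseteq> A - {0}"
    "generated_semigroup ((\<lambda>g. lead_exp r g a) ` G) = lead_exps r A a"
    "(\<lambda>g. lead_exp r g a) ` G = irreducibles (lead_exps r A a)"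
    "g \<in> G \<Longrightarrow> mfps_nth g (lead_exp r g a) = 1"
    "g \<in> G \<Longrightarrow> Supp g \<inter> lead_exps r A a = {lead_exp r g a}"
proof -
  let ?S = "lead_exps r A a" and ?E = "(\<lambda>g. lead_exp r g a) ` G"
  have min: "minimal_canonical_basis r A a G"
    and one: "\<And>g. g \<in> G \<Longrightarrow> mfps_nth g (lead_exp r g a) = 1"
    and red: "\<And>g \<alpha>. g \<in> G \<Longrightarrow> \<alpha> \<in> Supp (g - lead_monomial r g a) \<Longrightarrow> monomial 1 \<alpha> \<notin> lead_monomial_algebra r A a"
    using G by (auto simp: reduced_canonical_basis_def)
  show fin: "finite G" and GA: "G \<subseteq> A - {0}" and gen: "generated_semigroup ?E = ?S"
    using min by (auto simp: minimal_canonical_basis_def canonical_basis_def)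
  show "g \<in> G \<Longrightarrow> mfps_nth g (lead_exp r g a) = 1" by (rule one)
  show "Supp g \<inter> ?S = {lead_exp r g a}" if g: "g \<in> G"
  proof (intro equalityI subsetI)
    fix \<alpha> assume \<alpha>: "\<alpha> \<in> Supp g \<inter> ?S"
    then have "monomial (1 :: 'k) \<alpha> \<in> lead_monomial_algebra r A a"
      by (auto simp: lead_monomial_algebra_eq[OF A] in_Supp_iff split: if_splits)
    then have "\<alpha> \<notin> Supp (g - lead_monomial r g a)" using red[OF g] by blast
    with \<alpha> show "\<alpha> \<in> {lead_exp r g a}" by (auto simp: in_Supp_iff lead_monomial_def split: if_splits)
  next
    fix \<alpha> assume "\<alpha> \<in> {lead_exp r g a}"
    then show "\<alpha> \<in> Supp g \<inter> ?S" using GA g lead_exp_in_Supp[of g] by (auto simp: lead_exps_def)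
  qed
  have M: "(\<lambda>g. lead_monomial r g a) ` G = monomial 1 ` ?E"
    by (simp add: lead_monomial_def one image_image)
  show "?E = irreducibles ?S"
  proof (rule ccontr)
    assume "?E \<noteq> irreducibles ?S"
    with irreducibles_subset_generators[of ?E] gen have sub: "irreducibles ?S \<subset> ?E" by auto
    have inj: "inj (monomial (1 :: 'k))"
      by (rule injI) (metis mfps_nth_monomial zero_neq_one)
    have "monomial (1 :: 'k) ` irreducibles ?S \<subset> monomial 1 ` ?E"
      using sub inj by (metis image_strict_mono inj_on_subset subset_UNIV)
    moreover have "ps_algebra (monomial (1 :: 'k) ` irreducibles ?S) = lead_monomial_algebra r A a"
      by (simp add: ps_algebra_unit_monomials lead_monomial_algebra_eq[OF A]
          generated_semigroup_lead_exps[OF A])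
    ultimately show False using min unfolding minimal_canonical_basis_def M by blast
  qed
qed

text \<open>The basis consists of the reduced elements attached to the irreducible leading exponents. Any other
  reduced basis has the same leading exponents, and an element is determined by its leading exponent
  by \<open>reduced_element_unique\<close>.\<close>

lemma reduced_canonical_basis_ex1:
  fixes A :: "('k::field, 'n) mfps set"
  assumes A: "closed_subalgebra A" and E: "finite E" "lead_exps r A a = generated_semigroup E"
  shows "\<exists>!G. reduced_canonical_basis r A a G"
proof (rule ex_ex1I)
  let ?S = "lead_exps r A a"
  let ?I = "irreducibles ?S"
  have fin: "finite ?I" using irreducibles_subset_generators[of E] E finite_subset by metis
  have IS: "?I \<subseteq> ?S" by (auto simp: irreducibles_def)
  have "\<exists>g\<in>A. Supp g \<inter> ?S = {e} \<and> mfps_nth g e = 1" if "e \<in> ?I" for e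
    using reduced_element_exists[OF A, of e] that IS unfolding lead_exps_eq by blast
  then obtain g where g: "\<And>e. e \<in> ?I \<Longrightarrow> g e \<in> A" "\<And>e. e \<in> ?I \<Longrightarrow> Supp (g e) \<inter> ?S = {e}"
    "\<And>e. e \<in> ?I \<Longrightarrow> mfps_nth (g e) e = 1" by metis
  have nz: "g e \<noteq> 0" if "e \<in> ?I" for e using g(3)[OF that] by auto
  have le: "lead_exp r (g e) a = e" if "e \<in> ?I" for e
  proof -
    have "lead_exp r (g e) a \<in> Supp (g e) \<inter> ?S"
      using lead_exp_in_Supp[OF nz[OF that]] g(1)[OF that] nz[OF that] by (auto simp: lead_exps_def)
    then show ?thesis using g(2)[OF that] by simp
  qed
  have E': "(\<lambda>f. lead_exp r f a) ` (g ` ?I) = ?I"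
    using le by (force simp: image_image)
  have M: "(\<lambda>f. lead_monomial r f a) ` (g ` ?I) = monomial 1 ` ?I"
    unfolding image_image by (rule image_cong) (simp_all add: lead_monomial_def le g(3))
  have "canonical_basis r A a (g ` ?I)"
    unfolding canonical_basis_def E' using fin g(1) nz generated_semigroup_lead_exps(2)[OF A] by auto
  moreover have "ps_algebra H \<noteq> lead_monomial_algebra r A a" if H: "H \<subset> monomial 1 ` ?I" for H
  proof
    assume eq: "ps_algebra H = lead_monomial_algebra r A a"
    from H have "H \<subseteq> monomial 1 ` ?I" by blast
    then obtain F where F: "F \<subseteq> ?I" "H = monomial 1 ` F" by (auto simp: subset_image_iff)
    then have "{f :: ('k, 'n) mfps. Supp f \<subseteq> generated_semigroup F} = {f. Supp f \<subseteq> ?S}"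
      using eq by (simp add: ps_algebra_unit_monomials lead_monomial_algebra_eq[OF A])
    then have *: "Supp f \<subseteq> generated_semigroup F \<longleftrightarrow> Supp f \<subseteq> ?S" for f :: "('k, 'n) mfps"
      unfolding set_eq_iff mem_Collect_eq by blast
    have "Supp (monomial (1 :: 'k) \<alpha>) = {\<alpha>}" for \<alpha> :: "nat ^ 'n" by (auto simp: in_Supp_iff split: if_splits)
    with * have "{\<alpha>} \<subseteq> generated_semigroup F \<longleftrightarrow> {\<alpha>} \<subseteq> ?S" for \<alpha>
      by metis
    then have "generated_semigroup F = ?S" by blast
    then have "?I \<subseteq> F" using irreducibles_subset_generators[of F] by simp
    with F H show False by blast
  qed
  moreover have "ps_algebra (monomial (1 :: 'k) ` ?I) = lead_monomial_algebra r A a"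
    by (simp add: ps_algebra_unit_monomials lead_monomial_algebra_eq[OF A]
        generated_semigroup_lead_exps[OF A])
  ultimately have "minimal_canonical_basis r A a (g ` ?I)"
    unfolding minimal_canonical_basis_def M by blast
  moreover have "monomial 1 \<alpha> \<notin> lead_monomial_algebra r A a"
    if "e \<in> ?I" "\<alpha> \<in> Supp (g e - lead_monomial r (g e) a)" for e \<alpha>
  proof
    assume "monomial 1 \<alpha> \<in> lead_monomial_algebra r A a"
    then have "\<alpha> \<in> ?S" by (auto simp: lead_monomial_algebra_eq[OF A] in_Supp_iff)
    moreover have "\<alpha> \<in> Supp (g e)" "\<alpha> \<noteq> e"
      using that by (auto simp: lead_monomial_def le g(3) in_Supp_iff split: if_splits)
    ultimately show False using g(2)[OF that(1)] by blast
  qed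
  ultimately have "reduced_canonical_basis r A a (g ` ?I)"
    unfolding reduced_canonical_basis_def using le g(3) by auto
  then show "\<exists>G. reduced_canonical_basis r A a G" by blast
next
  have sub: "G \<subseteq> G'" if G: "reduced_canonical_basis r A a G" and G': "reduced_canonical_basis r A a G'" for G G'
  proof
    fix g assume g: "g \<in> G"
    note D = reduced_canonical_basisD[OF A G] and D' = reduced_canonical_basisD[OF A G']
    have "lead_exp r g a \<in> (\<lambda>g. lead_exp r g a) ` G'" unfolding D'(4) D(4)[symmetric] using g by (rule imageI)
    then obtain g' where g': "g' \<in> G'" "lead_exp r g' a = lead_exp r g a" by force
    have "g \<in> A" "g' \<in> A" using D(2) g D'(2) g'(1) by blast+
    have "g = g'"
      using \<open>g \<in> A\<close> D(6)[OF g] D(5)[OF g] \<open>g' \<in> A\<close> D'(6)[OF g'(1)] D'(5)[OF g'(1)]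
      unfolding lead_exps_eq g'(2) by (rule reduced_element_unique[OF A])
    with g' show "g \<in> G'" by simp
  qed
  show "G = G'" if "reduced_canonical_basis r A a G" "reduced_canonical_basis r A a G'" for G G'
    using sub that by blast
qed

lemma reduced_canonical_basis_card_le:
  fixes A :: "('k::field, 'n) mfps set"
  assumes A: "closed_subalgebra A" and le: "canonical_basis_size r A a \<le> enat N"
  obtains G where "reduced_canonical_basis r A a G" "card G \<le> N"
proof -
  from le obtain E where E: "finite E" "lead_exps r A a = generated_semigroup E"
    by (auto simp: canonical_basis_size_def split: if_splits)
  with le have "card (THE G. reduced_canonical_basis r A a G) \<le> N"
    by (auto simp: canonical_basis_size_def split: if_splits)
  with theI'[OF reduced_canonical_basis_ex1[OF A E]] show thesis by (rule that)
qed

end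

section \<open>Initial forms of a single series under varying weights\<close>

lemma nu_le:
  assumes a: "a \<in> positive_weights" and \<alpha>: "\<alpha> \<in> Supp f"
  shows "nu f a \<le> weight a \<alpha>"
proof -
  let ?W = "weight a ` {\<beta>\<in>Supp f. weight a \<beta> \<le> weight a \<alpha>}"
  have W: "finite ?W" "?W \<noteq> {}"
    using finite_subset[OF _ finite_weight_le[OF a, of "weight a \<alpha>"], of "{\<beta>\<in>Supp f. weight a \<beta> \<le> weight a \<alpha>}"] \<alpha>
    by auto
  have "nu f a = Min ?W"
    unfolding nu_def
  proof (rule Least_equality)
    show "Min ?W \<in> weight a ` Supp f" using Min_in[OF W] by blast
    fix v assume "v \<in> weight a ` Supp f"
    then obtain \<beta> where \<beta>: "\<beta> \<in> Supp f" "v = weight a \<beta>" by blast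
    show "Min ?W \<le> v"
    proof (cases "v \<le> weight a \<alpha>")
      case True
      then show ?thesis using \<beta> by (intro Min_le[OF W(1)]) blast
    next
      case False
      moreover have "Min ?W \<le> weight a \<alpha>" using \<alpha> by (intro Min_le[OF W(1)]) blast
      ultimately show ?thesis by simp
    qed
  qed
  also have "Min ?W \<le> weight a \<alpha>" using \<alpha> by (intro Min_le[OF W(1)]) blast
  finally show ?thesis .
qed

lemma weight_strict_mono:
  assumes a: "a \<in> positive_weights" and le: "\<forall>i. \<alpha> $ i \<le> \<beta> $ i" and ne: "\<alpha> \<noteq> \<beta>"
  shows "weight a \<alpha> < weight a \<beta>"
proof -
  from ne obtain j where "\<alpha> $ j \<noteq> \<beta> $ j" by (auto simp: vec_eq_iff)
  with le have "\<alpha> $ j < \<beta> $ j" by (simp add: le_neq_implies_less)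
  with a le show ?thesis
    unfolding weight_def positive_weights_def
    by (intro sum_strict_mono_ex1) (auto intro!: mult_left_mono mult_strict_left_mono less_imp_le)
qed

text \<open>Weights are strictly monotone in each coordinate, so whatever the positive weight is, an exponent of
  least weight is minimal in the support for the componentwise order. Dickson's lemma provides a
  finite set \<open>D\<close> containing all of these.\<close>

lemma Supp_initial_form_subset_minimal:
  fixes f :: "('a::zero, 'n::finite) mfps"
  shows "\<exists>D. finite D \<and> (\<forall>a\<in>positive_weights. Supp (initial_form f a) \<subseteq> D)"
proof -
  obtain D where D: "D \<subseteq> Supp f" "finite D" "\<forall>x\<in>Supp f. \<exists>d\<in>D. \<forall>i. d $ i \<le> x $ i"
    using dickson[of "Supp f"] by blast
  have "\<alpha> \<in> D" if a: "a \<in> positive_weights" and \<alpha>: "\<alpha> \<in> Supp (initial_form f a)" for a \<alpha>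
  proof -
    have "\<alpha> \<in> Supp f" "weight a \<alpha> = nu f a" using \<alpha> by (auto simp: initial_form_eq in_Supp_iff split: if_splits)
    then obtain d where d: "d \<in> D" "\<forall>i. d $ i \<le> \<alpha> $ i" using D(3) by blast
    show "\<alpha> \<in> D"
    proof (rule ccontr)
      assume "\<alpha> \<notin> D"
      with d have "weight a d < weight a \<alpha>" by (intro weight_strict_mono[OF a]) auto
      moreover have "nu f a \<le> weight a d" using nu_le[OF a] D(1) d(1) by blast
      ultimately show False using \<open>weight a \<alpha> = nu f a\<close> by simp
    qed
  qed
  with D(2) show ?thesis by blast
qed

lemma finite_initial_forms:
  fixes f :: "('a::zero, 'n::finite) mfps"
  shows "finite ((\<lambda>a. initial_form f a) ` positive_weights)"
proof -
  obtain D where D: "finite D" "\<forall>a\<in>positive_weights. Supp (initial_form f a) \<subseteq> D"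
    using Supp_initial_form_subset_minimal by blast
  have "initial_form f a = Abs_mfps (\<lambda>\<alpha>. if \<alpha> \<in> Supp (initial_form f a) then mfps_nth f \<alpha> else 0)" for a
    by (rule mfps_eqI) (simp add: Abs_mfps_inverse initial_form_eq in_Supp_iff)
  then have "(\<lambda>a. initial_form f a) ` positive_weights \<subseteq>
      (\<lambda>T. Abs_mfps (\<lambda>\<alpha>. if \<alpha> \<in> T then mfps_nth f \<alpha> else 0)) ` Pow D"
    using D(2) by blast
  then show ?thesis using D(1) finite_subset by blast
qed

lemma finite_lead_exp_values:
  assumes r: "compatible_well_order r" and f: "(f :: ('k::field, 'n::finite) mfps) \<noteq> 0"
  shows "finite ((\<lambda>a. lead_exp r f a) ` positive_weights)"
proof -
  have "(\<lambda>a. lead_exp r f a) ` positive_weights =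
      (\<lambda>h. THE \<mu>. \<mu> \<in> Supp h \<and> (\<forall>\<alpha>\<in>Supp h. (\<alpha>, \<mu>) \<in> r)) ` (\<lambda>a. initial_form f a) ` positive_weights"
    by (simp add: image_image lead_exp_def)
  then show ?thesis using finite_initial_forms[of f] by simp
qed

section \<open>Finiteness of the semigroups of leading exponents\<close>

text \<open>\<open>L\<close> is the limit of the semigroups \<open>S y\<close> along a suitable infinite subfamily. The uniform bound \<open>N\<close> on
  the number of generators is what puts the limit inside the members: the generators that are
  constant along the subfamily generate \<open>L\<close>, and only finitely many members have one of the
  remaining generators below a given exponent.\<close>

lemma infinite_family_accumulates:
  fixes S :: "'i \<Rightarrow> (nat ^ 'n::finite) set"
  assumes X: "infinite X"
    and gen: "\<And>x. x \<in> X \<Longrightarrow> \<exists>E. finite E \<and> card E \<le> N \<and> S x = generated_semigroup E"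
  obtains Y L where "Y \<subseteq> X" "infinite Y" "\<And>y. y \<in> Y \<Longrightarrow> L \<subseteq> S y"
    "\<And>\<alpha>. infinite {y\<in>Y. \<alpha> \<in> S y} \<Longrightarrow> \<alpha> \<in> L" "\<And>E. E \<subseteq> L \<Longrightarrow> generated_semigroup E \<subseteq> L"
proof -
  \<comment> \<open>Padding with the harmless generator 0 gives every member exactly \<open>N\<close> indexed generators.\<close>
  have "\<exists>\<epsilon>. S x = generated_semigroup (\<epsilon> ` {..<N})" if x: "x \<in> X" for x
  proof -
    obtain E where E: "finite E" "card E \<le> N" "S x = generated_semigroup E" using gen[OF x] by blast
    obtain h where h: "bij_betw h {0..<card E} E" using ex_bij_betw_nat_finite[OF E(1)] by blast
    define \<epsilon> where "\<epsilon> j = (if j < card E then h j else 0)" for j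
    have "insert 0 (\<epsilon> ` {..<N}) = insert 0 E"
      using h E(2) by (fastforce simp: \<epsilon>_def bij_betw_def image_iff)
    then have "S x = generated_semigroup (\<epsilon> ` {..<N})"
      using E(3) generated_semigroup_insert_zero by metis
    then show ?thesis by blast
  qed
  then obtain \<epsilon> where \<epsilon>: "\<And>x. x \<in> X \<Longrightarrow> S x = generated_semigroup (\<epsilon> x ` {..<N})" by metis
  obtain Y where Y: "Y \<subseteq> X" "infinite Y" and
    alt: "\<forall>j\<in>{..<N}. (\<exists>c. \<forall>y\<in>Y. \<epsilon> y j = c) \<or> (\<forall>c. finite {y\<in>Y. \<epsilon> y j = c})"
    using infinite_subset_constant_or_finite_to_one[of "{..<N}" X "\<lambda>j y. \<epsilon> y j"] X by auto
  define J where "J = {j. j < N \<and> (\<exists>c. \<forall>y\<in>Y. \<epsilon> y j = c)}"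
  obtain y0 where y0: "y0 \<in> Y" using Y(2) by fastforce
  have const: "\<epsilon> y j = \<epsilon> y0 j" if "j \<in> J" "y \<in> Y" for y j
    using that y0 unfolding J_def by auto
  define L where "L = generated_semigroup (\<epsilon> y0 ` J)"
  have "L \<subseteq> S y" if y: "y \<in> Y" for y
  proof -
    have "\<epsilon> y0 ` J \<subseteq> \<epsilon> y ` {..<N}" using const[OF _ y] by (force simp: J_def)
    then show ?thesis using \<epsilon>[of y] y Y(1) unfolding L_def by (metis generated_semigroup_mono subsetD)
  qed
  moreover have "\<alpha> \<in> L" if inf: "infinite {y\<in>Y. \<alpha> \<in> S y}" for \<alpha>
  proof -
    \<comment> \<open>The members in which some nonconstant generator could contribute to \<open>\<alpha>\<close>.\<close>
    let ?B = "\<Union>j\<in>{..<N} - J. \<Union>\<beta>\<in>{\<beta>. \<forall>i. \<beta> $ i \<le> \<alpha> $ i}. {y\<in>Y. \<epsilon> y j = \<beta>}"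
    have "finite {y\<in>Y. \<epsilon> y j = \<beta>}" if "j \<in> {..<N} - J" for j \<beta>
      using that bspec[OF alt, of j] by (auto simp: J_def)
    then have "finite ?B" by (intro finite_UN_I finite_exponents_le) auto
    then obtain y where y: "y \<in> Y" "\<alpha> \<in> S y" "y \<notin> ?B"
      using inf by (metis (no_types, lifting) finite_subset mem_Collect_eq subsetI)
    then have "\<alpha> \<in> generated_semigroup {\<beta>\<in>\<epsilon> y ` {..<N}. \<forall>i. \<beta> $ i \<le> \<alpha> $ i}"
      using \<epsilon>[of y] Y(1) generated_semigroup_below by blast
    moreover have "{\<beta>\<in>\<epsilon> y ` {..<N}. \<forall>i. \<beta> $ i \<le> \<alpha> $ i} \<subseteq> \<epsilon> y0 ` J"
      using y const[OF _ y(1)] by fastforce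
    ultimately show ?thesis unfolding L_def using generated_semigroup_mono by blast
  qed
  moreover have "generated_semigroup E \<subseteq> L" if "E \<subseteq> L" for E
    using generated_semigroup_least that unfolding L_def by blast
  ultimately show thesis using that Y by blast
qed

text \<open>If there were infinitely many semigroups, the elements of each reduced basis along the accumulating
  subfamily would have their leading exponents in the limit \<open>L\<close>, which forces every semigroup of the
  subfamily to equal \<open>L\<close>.\<close>

lemma finite_lead_exps:
  fixes A :: "('k::field, 'n::finite) mfps set"
  assumes r: "compatible_well_order r" and A: "closed_subalgebra A"
    and N: "\<And>a. a \<in> positive_weights \<Longrightarrow> canonical_basis_size r A a \<le> enat N"
  shows "finite (lead_exps r A ` positive_weights)"
proof (rule ccontr)
  assume "infinite (lead_exps r A ` positive_weights)"
  moreover obtain X where X: "X \<subseteq> positive_weights" "inj_on (lead_exps r A) X"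
    "lead_exps r A ` X = lead_exps r A ` positive_weights"
    using subset_image_inj[of "lead_exps r A ` positive_weights" "lead_exps r A" positive_weights]
    by (metis order_refl)
  ultimately have infX: "infinite X" by (metis finite_imageI)
  have "\<exists>G. reduced_canonical_basis r A a G \<and> card G \<le> N" if "a \<in> X" for a
  proof -
    have a: "a \<in> positive_weights" using \<open>a \<in> X\<close> X(1) by blast
    show ?thesis by (rule reduced_canonical_basis_card_le[OF r a A N[OF a]]) blast
  qed
  then obtain G where G: "\<And>a. a \<in> X \<Longrightarrow> reduced_canonical_basis r A a (G a)"
    and card: "\<And>a. a \<in> X \<Longrightarrow> card (G a) \<le> N" by metis
  note GD = reduced_canonical_basisD[OF r _ A G]
  have gens: "\<exists>E. finite E \<and> card E \<le> N \<and> lead_exps r A a = generated_semigroup E" if "a \<in> X" for a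
  proof (intro exI conjI)
    have a: "a \<in> positive_weights" using that X(1) by blast
    show "finite ((\<lambda>g. lead_exp r g a) ` G a)" using GD(1)[OF a that] by simp
    show "card ((\<lambda>g. lead_exp r g a) ` G a) \<le> N"
      using card_image_le[OF GD(1)[OF a that]] card[OF that] by (rule order_trans)
    show "lead_exps r A a = generated_semigroup ((\<lambda>g. lead_exp r g a) ` G a)"
      by (rule GD(3)[OF a that, symmetric])
  qed
  obtain Y L where Y: "Y \<subseteq> X" "infinite Y" "\<And>y. y \<in> Y \<Longrightarrow> L \<subseteq> lead_exps r A y"
    and acc: "\<And>\<alpha>. infinite {y\<in>Y. \<alpha> \<in> lead_exps r A y} \<Longrightarrow> \<alpha> \<in> L"
    and L: "\<And>E. E \<subseteq> L \<Longrightarrow> generated_semigroup E \<subseteq> L"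
    by (rule infinite_family_accumulates[where S = "lead_exps r A", OF infX gens]) (assumption, rule that)
  have "lead_exps r A a = L" if a: "a \<in> Y" for a
  proof
    have aX: "a \<in> X" "a \<in> positive_weights" using a X(1) Y(1) by auto
    have "lead_exp r g a \<in> L" if g: "g \<in> G a" for g
    proof -
      have gA: "g \<in> A - {0}" using GD(2)[OF aX(2,1)] g by blast
      then have nz: "g \<noteq> 0" by blast
      have "Y \<subseteq> positive_weights" using X(1) Y(1) by blast
      then have "finite ((\<lambda>b. lead_exp r g b) ` Y)"
        using finite_lead_exp_values[OF r nz] finite_subset image_mono by metis
      \<comment> \<open>One of the finitely many leading exponents of \<open>g\<close> recurs for infinitely many weights, so it
  belongs to the limit.\<close>
      then obtain b where b: "b \<in> Y" "infinite {y\<in>Y. lead_exp r g y = lead_exp r g b}"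
        using pigeonhole_infinite[OF Y(2)] by blast
      have "lead_exp r g y \<in> lead_exps r A y" for y using gA unfolding lead_exps_def by (rule imageI)
      then have sub: "{y\<in>Y. lead_exp r g y = lead_exp r g b} \<subseteq> {y\<in>Y. lead_exp r g b \<in> lead_exps r A y}"
        by (metis (mono_tags, lifting) Collect_mono)
      have bL: "lead_exp r g b \<in> L" by (rule acc[OF infinite_super[OF sub b(2)]])
      have "lead_exp r g b \<in> Supp g"
        using lead_exp_in_Supp[OF r _ nz, of b] b(1) X(1) Y(1) by blast
      with bL Y(3)[OF a] have "lead_exp r g b \<in> Supp g \<inter> lead_exps r A a" by blast
      \<comment> \<open>By reducedness, \<open>g\<close> has no other exponent in \<open>lead_exps r A a\<close>.\<close>
      then have "lead_exp r g b = lead_exp r g a" using GD(6)[OF aX(2,1) g] by blast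
      with bL show ?thesis by simp
    qed
    then have "(\<lambda>g. lead_exp r g a) ` G a \<subseteq> L" by (rule image_subsetI)
    from L[OF this] show "lead_exps r A a \<subseteq> L" unfolding GD(3)[OF aX(2,1)] .
    show "L \<subseteq> lead_exps r A a" by (rule Y(3)[OF a])
  qed
  then have "lead_exps r A ` Y \<subseteq> {L}" by blast
  moreover have "inj_on (lead_exps r A) Y" using X(2) Y(1) inj_on_subset by blast
  ultimately show False using Y(2) by (meson finite.emptyI finite_insert finite_imageD finite_subset)
qed

section \<open>Initial algebras\<close>

text \<open>Under the lower bounds, an exponent of weight \<open>v + w\<close> in the product can only arise from exponents of
  weights exactly \<open>v\<close> and \<open>w\<close>.\<close>

lemma homogeneous_part_times:
  assumes f: "\<And>\<alpha>. \<alpha> \<in> Supp f \<Longrightarrow> v \<le> weight a \<alpha>" and g: "\<And>\<alpha>. \<alpha> \<in> Supp g \<Longrightarrow> w \<le> weight a \<alpha>"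
  shows "homogeneous_part a (v + w) (f * g) = homogeneous_part a v f * homogeneous_part a w g"
proof (rule mfps_eqI)
  fix \<gamma>
  have "mfps_nth f (fst p) * mfps_nth g (snd p) =
      mfps_nth (homogeneous_part a v f) (fst p) * mfps_nth (homogeneous_part a w g) (snd p)"
    if "fst p + snd p = \<gamma>" "weight a \<gamma> = v + w" for p
  proof (cases "fst p \<in> Supp f \<and> snd p \<in> Supp g")
    case True
    then have "weight a (fst p) = v \<and> weight a (snd p) = w"
      using f[of "fst p"] g[of "snd p"] that weight_add[of a "fst p" "snd p"] by simp
    then show ?thesis by simp
  qed (auto simp: in_Supp_iff)
  moreover have "mfps_nth (homogeneous_part a v f) (fst p) * mfps_nth (homogeneous_part a w g) (snd p) = 0"
    if "fst p + snd p = \<gamma>" "weight a \<gamma> \<noteq> v + w" for p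
    using that weight_add[of a "fst p" "snd p"] by auto
  ultimately show "mfps_nth (homogeneous_part a (v + w) (f * g)) \<gamma> =
      mfps_nth (homogeneous_part a v f * homogeneous_part a w g) \<gamma>"
    unfolding mfps_nth_homogeneous_part mfps_nth_times
    by (auto intro!: sum.cong sum.neutral[symmetric] simp del: mfps_nth_homogeneous_part)
qed

context
  fixes r :: "(nat ^ 'n::finite) rel" and a :: "real ^ 'n"
  assumes r: "compatible_well_order r" and a: "a \<in> positive_weights"
begin

interpretation omega_order "rank r a" by (rule omega_order_rank[OF r a])

lemma initial_form_eq_lead:
  "(f :: ('k::field, 'n) mfps) \<noteq> 0 \<Longrightarrow> initial_form f a = homogeneous_part a (weight a (lead f)) f"
  by (simp add: initial_form_eq nu_eq[OF r a])

lemma initial_form_times: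
  fixes f g :: "('k::field, 'n) mfps"
  assumes "f \<noteq> 0" "g \<noteq> 0"
  shows "initial_form (f * g) a = initial_form f a * initial_form g a"
  unfolding initial_form_eq_lead[OF assms(1)] initial_form_eq_lead[OF assms(2)]
    initial_form_eq_lead[OF times_nonzero[OF assms]] lead_times[OF assms] weight_add
  by (rule homogeneous_part_times)
     (use assms lead_least weight_mono_rank[OF r a] in blast)+

text \<open>Division by the basis within a single weight: a product \<open>p\<close> of basis elements has the same leading
  exponent as \<open>f\<close>, and subtracting a multiple of \<open>p\<close> from \<open>f\<close> either removes the whole part of that weight
  or leaves a remainder of the same weight with a smaller leading exponent for \<open>r\<close>. The latter
  cannot go on forever as \<open>r\<close> is a well ordering.\<close>

lemma initial_form_in_generated_subalgebra:
  fixes A :: "('k::field, 'n) mfps set"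
  assumes A: "closed_subalgebra A" and G: "canonical_basis r A a G" and f: "f \<in> A - {0}"
  shows "initial_form f a \<in> generated_subalgebra ((\<lambda>g. initial_form g a) ` G)"
proof -
  let ?B = "generated_subalgebra ((\<lambda>g. initial_form g a) ` G)"
  have GA: "G \<subseteq> A - {0}" and gen: "lead ` (A - {0}) = generated_semigroup (lead ` G)"
    using G by (auto simp: canonical_basis_def lead_exps_eq[OF r a] lead_exp_eq[OF r a] subset_iff cong: image_cong_simp)
  have product: "\<exists>p\<in>A - {0}. lead p = \<alpha> \<and> initial_form p a \<in> ?B" if "\<alpha> \<in> lead ` (A - {0})" for \<alpha>
    using that unfolding gen
  proof induction
    case zero
    have "initial_form (1 :: ('k, 'n) mfps) a = monomial 1 0"
      using initial_form_eq_lead[of "1 :: ('k, 'n) mfps"] lead_monomial_zero[of "1 :: 'k"]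
      by (intro mfps_eqI) (auto simp: monomial_one_zero one_mfps.rep_eq)
    then show ?case
      using closed_subalgebraD(2)[OF A, of 1] lead_monomial_zero[of "1 :: 'k"]
      by (intro bexI[of _ 1]) (auto simp: monomial_one_zero intro: generated_subalgebra.const[of 1, unfolded monomial_one_zero])
  next
    case (base \<alpha>)
    then show ?case using GA by (auto intro: generated_subalgebra.base)
  next
    case (add \<alpha> \<beta>)
    then obtain p q where "p \<in> A - {0}" "lead p = \<alpha>" "initial_form p a \<in> ?B"
      "q \<in> A - {0}" "lead q = \<beta>" "initial_form q a \<in> ?B" by blast
    then show ?case
      using closed_subalgebraD(4)[OF A]
      by (intro bexI[of _ "p * q"]) (auto simp: times_nonzero lead_times initial_form_times intro: generated_subalgebra.mult)
  qed
  have "f \<in> A - {0} \<longrightarrow> lead f = \<alpha> \<longrightarrow> initial_form f a \<in> ?B" for f \<alpha>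
  proof (induction \<alpha> arbitrary: f rule: wf_induct_rule[OF compatible_well_orderD(6)[OF r]])
    case (1 \<alpha>)
    show ?case
    proof (intro impI)
      assume f: "f \<in> A - {0}" and \<alpha>: "lead f = \<alpha>"
      then have "\<alpha> \<in> lead ` (A - {0})" by blast
      then obtain p where p: "p \<in> A - {0}" "lead p = \<alpha>" "initial_form p a \<in> ?B" using product by blast
      define c where "c = mfps_nth f \<alpha> / mfps_nth p \<alpha>"
      define h where "h = f - monomial c 0 * p"
      have hA: "h \<in> A"
        using f p closed_subalgebraD(2,4)[OF A] unfolding h_def by (intro closed_subalgebra_diff[OF A]) auto
      have nz: "f \<noteq> 0" "p \<noteq> 0" using f p by auto
      have h\<alpha>: "mfps_nth h \<alpha> = 0" using lead_in_Supp[OF nz(2)] p(2) by (simp add: h_def c_def in_Supp_iff)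
      have h_supp: "rank r a \<alpha> \<le> rank r a \<beta>" if "\<beta> \<in> Supp h" for \<beta>
      proof (cases "\<beta> \<in> Supp f")
        case True
        then show ?thesis using lead_least[OF nz(1)] \<alpha> by blast
      next
        case False
        then have "\<beta> \<in> Supp p" using that by (auto simp: h_def in_Supp_iff)
        then show ?thesis using lead_least[OF nz(2)] p(2) by blast
      qed
      have split: "initial_form f a = homogeneous_part a (weight a \<alpha>) h + monomial c 0 * initial_form p a"
        unfolding initial_form_eq_lead[OF nz(1)] initial_form_eq_lead[OF nz(2)] \<alpha> p(2) h_def
        by (rule mfps_eqI) simp
      have "homogeneous_part a (weight a \<alpha>) h \<in> ?B"
      proof (cases "homogeneous_part a (weight a \<alpha>) h = 0")
        case True
        have "(0 :: ('k, 'n) mfps) = monomial 0 0" by (rule mfps_eqI) simp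
        then show ?thesis unfolding True by (metis generated_subalgebra.const)
      next
        case False
        then obtain \<beta> where "\<beta> \<in> Supp (homogeneous_part a (weight a \<alpha>) h)" using Supp_eq_empty_iff by blast
        then have \<beta>: "\<beta> \<in> Supp h" "weight a \<beta> = weight a \<alpha>" by (auto simp: in_Supp_iff split: if_splits)
        then have hnz: "h \<noteq> 0" by (auto simp: in_Supp_iff)
        have "rank r a \<alpha> \<le> rank r a (lead h)" using h_supp lead_in_Supp[OF hnz] by blast
        moreover have ne: "lead h \<noteq> \<alpha>" using h\<alpha> lead_in_Supp[OF hnz] by (auto simp: in_Supp_iff)
        ultimately have "rank r a \<alpha> < rank r a (lead h)" by (metis le_neq_implies_less rk_eq_iff)
        moreover have w: "weight a (lead h) = weight a \<alpha>"
          using \<beta> weight_mono_rank[OF r a] lead_least[OF hnz \<beta>(1)] h_supp lead_in_Supp[OF hnz] by (metis le_antisym order_antisym)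
        ultimately have "(lead h, \<alpha>) \<in> r - Id" using ne by (auto simp: rank_less_iff[OF r a] precedes_def)
        then have "initial_form h a \<in> ?B" using 1 hA hnz by blast
        then show ?thesis by (simp add: initial_form_eq_lead[OF hnz] w)
      qed
      then show "initial_form f a \<in> ?B"
        unfolding split using p(3) by (intro generated_subalgebra.add generated_subalgebra.mult generated_subalgebra.const)
    qed
  qed
  with f show ?thesis by blast
qed

lemma initial_algebra_eq:
  fixes A :: "('k::field, 'n) mfps set"
  assumes A: "closed_subalgebra A" and G: "canonical_basis r A a G"
  shows "initial_algebra A a = ps_algebra ((\<lambda>g. initial_form g a) ` G)"
proof
  show "initial_algebra A a \<subseteq> ps_algebra ((\<lambda>g. initial_form g a) ` G)"
    unfolding initial_algebra_def
    using initial_form_in_generated_subalgebra[OF A G] generated_subalgebra_subset_ps_algebra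
    by (intro ps_algebra_subset closed_subalgebra_ps_algebra) blast
  show "ps_algebra ((\<lambda>g. initial_form g a) ` G) \<subseteq> initial_algebra A a"
    unfolding initial_algebra_def
    by (intro ps_algebra_mono image_mono) (use G in \<open>simp add: canonical_basis_def\<close>)
qed

end

text \<open>An element of \<open>G\<close> has only one exponent that may be leading for \<open>b\<close>, namely the one in the common
  semigroup, so changing the weight from \<open>a\<close> to \<open>b\<close> does not move its leading exponent.\<close>

lemma canonical_basis_transfer:
  fixes A :: "('k::field, 'n::finite) mfps set"
  assumes r: "compatible_well_order r" and A: "closed_subalgebra A"
    and a: "a \<in> positive_weights" and b: "b \<in> positive_weights"
    and G: "reduced_canonical_basis r A a G" and eq: "lead_exps r A b = lead_exps r A a"
  shows "canonical_basis r A b G"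
proof -
  note D = reduced_canonical_basisD[OF r a A G]
  have "lead_exp r g b = lead_exp r g a" if g: "g \<in> G" for g
  proof -
    have "g \<in> A - {0}" using D(2) g by blast
    then have "lead_exp r g b \<in> Supp g \<inter> lead_exps r A a"
      using lead_exp_in_Supp[OF r b, of g] eq by (auto simp: lead_exps_def)
    then show ?thesis using D(6)[OF g] by blast
  qed
  then have "(\<lambda>g. lead_exp r g b) ` G = (\<lambda>g. lead_exp r g a) ` G" by (rule image_cong[OF refl])
  then show ?thesis using D(1-3) eq by (simp add: canonical_basis_def)
qed

text \<open>One basis \<open>G\<close> serves all these weights, so the algebra is determined by the set of initial forms of its
  elements.\<close>

lemma finite_initial_algebras_same_lead_exps:
  fixes A :: "('k::field, 'n::finite) mfps set"
  assumes r: "compatible_well_order r" and A: "closed_subalgebra A"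
    and a: "a \<in> positive_weights" and G: "reduced_canonical_basis r A a G"
  shows "finite (initial_algebra A ` {b\<in>positive_weights. lead_exps r A b = lead_exps r A a})"
proof -
  let ?F = "\<Union>g\<in>G. (\<lambda>b. initial_form g b) ` positive_weights"
  have "finite ?F" using reduced_canonical_basisD(1)[OF r a A G] finite_initial_forms by blast
  moreover have "initial_algebra A ` {b\<in>positive_weights. lead_exps r A b = lead_exps r A a}
      \<subseteq> ps_algebra ` Pow ?F"
  proof
    fix B assume "B \<in> initial_algebra A ` {b\<in>positive_weights. lead_exps r A b = lead_exps r A a}"
    then obtain b where b: "b \<in> positive_weights" "lead_exps r A b = lead_exps r A a" "B = initial_algebra A b"
      by blast
    have "B = ps_algebra ((\<lambda>g. initial_form g b) ` G)"
      unfolding b(3) by (rule initial_algebra_eq[OF r b(1) A canonical_basis_transfer[OF r A a b(1) G b(2)]])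
    then show "B \<in> ps_algebra ` Pow ?F" using b(1) by blast
  qed
  ultimately show ?thesis by (meson finite_Pow_iff finite_imageI finite_subset)
qed

theorem theorem37:
  fixes f :: "nat \<Rightarrow> ('k::field, 'n::finite) mfps"
    and s :: nat
    and r :: "(nat ^ 'n) rel"
    and A :: "('k, 'n) mfps set"
  assumes "compatible_well_order r"
    and "\<And>i. i \<in> {1..s} \<Longrightarrow> f i \<noteq> 0"
    and "A = ps_algebra (f ` {1..s})"
    and "\<exists>n0::nat. \<forall>a\<in>positive_weights. canonical_basis_size r A a \<le> enat n0"
  shows "finite {lead_monomial_algebra r A a | a. a \<in> positive_weights} \<and>
         finite {lead_exps r A a | a. a \<in> positive_weights} \<and>
         finite {initial_algebra A a | a. a \<in> positive_weights}"
proof -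
  note r = assms(1)
  have A: "closed_subalgebra A" unfolding assms(3) by (rule closed_subalgebra_ps_algebra)
  obtain N where N: "\<And>a. a \<in> positive_weights \<Longrightarrow> canonical_basis_size r A a \<le> enat N"
    using assms(4) by blast
  have fin: "finite (lead_exps r A ` positive_weights)" by (rule finite_lead_exps[OF r A N])
  have "lead_monomial_algebra r A ` positive_weights =
      (\<lambda>S. {f. Supp f \<subseteq> S}) ` lead_exps r A ` positive_weights"
    by (simp add: image_image lead_monomial_algebra_eq[OF r _ A])
  with fin have M: "finite (lead_monomial_algebra r A ` positive_weights)" by simp
  have "initial_algebra A ` positive_weights =
      (\<Union>S\<in>lead_exps r A ` positive_weights. initial_algebra A ` {b\<in>positive_weights. lead_exps r A b = S})"
    by blast
  moreover have "finite (initial_algebra A ` {b\<in>positive_weights. lead_exps r A b = S})"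
    if "S \<in> lead_exps r A ` positive_weights" for S
  proof -
    obtain a where a: "a \<in> positive_weights" "S = lead_exps r A a" using \<open>S \<in> _\<close> by blast
    obtain G where "reduced_canonical_basis r A a G"
      using reduced_canonical_basis_card_le[OF r a(1) A N[OF a(1)]] by blast
    then show ?thesis unfolding a(2) by (rule finite_initial_algebras_same_lead_exps[OF r A a(1)])
  qed
  ultimately have "finite (initial_algebra A ` positive_weights)" by (simp only: finite_UN_I[OF fin])
  with fin M show ?thesis by (simp add: setcompr_eq_image)
qed

end
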